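(* Let $d\geq 2$, $R_0>0$, $\Omega=B(0,R_0)\subset\mathbb{R}^d$, $\tau>0$, and let $u_0\in L^1_{c+}(\Omega)$ be radially non-increasing. Define, for $u\in L^1_{c+}(\Omega)$, \[ \mathcal{F}(u)=\overline{W}(u,\Omega)+\frac{1}{2\tau}\|u-u_0\|_{L^1}^2. \] Then for every $u\in L^1_{c+}(\Omega)$ there exists a radially non-increasing $\tilde{u}\in L^1_{c+}(\Omega)$ such that $\mathcal{F}(\tilde{u})\leq\mathcal{F}(u)$ (both values possibly being $+\infty$).
   Context: $L^1_{c+}(\Omega)=\{u\in L^1(\mathbb{R}^d): u\geq 0,\ \operatorname{supp}(u)\subset\Omega\}$. A function $u$ is radially non-increasing if there is $r:\mathbb{R}\to\mathbb{R}_+$ with $\{u\geq t\}=\overline{B}(0,r(t))$ up to a Lebesgue-negligible set for almost every $t$, where $\{u\geq t\}=\{x: u(x)\geq t\}$. For $u\in C^2_c(\Omega)$, $W(u)=\frac{1}{(d-1)^{d-1}}\int_{\mathbb{R}^d}|\nabla u|\,\big|\operatorname{div}\frac{\nabla u}{|\nabla u|}\big|^{d-1}dx$ (integrand $0$ where $\nabla u=0$); $W(u)=+\infty$ for $u\in L^1(\Omega)\setminus C^2_c(\Omega)$; $\overline{W}(u,\Omega)=\inf\{\liminf_n W(u_n): u_n\to u\text{ in }L^1(\Omega)\}$.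
   Formalization: In the definition of radially non-increasing, the condition that {u≥t} is a closed ball is required only for almost every t>0; for t<0 the set {u≥t} of a nonnegative u is all of ℝ^d, never a ball of finite radius, so the literal condition is unsatisfiable. *)

theory Defs
  imports "HOL-Analysis.Analysis"
begin

definition grad :: "('a::euclidean_space \<Rightarrow> real) \<Rightarrow> 'a \<Rightarrow> 'a" where
  "grad u x = (\<Sum>i\<in>Basis. frechet_derivative u (at x) i *\<^sub>R i)"

definition divg :: "('a::euclidean_space \<Rightarrow> 'a) \<Rightarrow> 'a \<Rightarrow> real" where
  "divg V x = (\<Sum>i\<in>Basis. frechet_derivative V (at x) i \<bullet> i)"

definition C2 :: "('a::euclidean_space \<Rightarrow> real) \<Rightarrow> bool" where
  "C2 u \<longleftrightarrow> (\<forall>x. u differentiable at x) \<and> (\<forall>x. grad u differentiable at x) \<and>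
     (\<forall>v. continuous_on UNIV (\<lambda>x. frechet_derivative (grad u) (at x) v))"

definition C2c :: "'a::euclidean_space set \<Rightarrow> ('a \<Rightarrow> real) \<Rightarrow> bool" where
  "C2c \<Omega> u \<longleftrightarrow> C2 u \<and> compact (closure {x. u x \<noteq> 0}) \<and> closure {x. u x \<noteq> 0} \<subseteq> \<Omega>"

definition esssupp :: "('a::euclidean_space \<Rightarrow> real) \<Rightarrow> 'a set" where
  "esssupp u = {x. \<forall>e>0. \<not> (AE y in lebesgue. y \<in> ball x e \<longrightarrow> u y = 0)}"

definition L1cp :: "'a::euclidean_space set \<Rightarrow> ('a \<Rightarrow> real) set" where
  "L1cp \<Omega> = {u. integrable lebesgue u \<and> (AE x in lebesgue. u x \<ge> 0) \<and> esssupp u \<subseteq> \<Omega>}"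

definition radially_nonincr :: "('a::euclidean_space \<Rightarrow> real) \<Rightarrow> bool" where
  "radially_nonincr u \<longleftrightarrow> (\<exists>r::real \<Rightarrow> real. (\<forall>t. r t \<ge> 0) \<and>
     (AE t in lborel. t > 0 \<longrightarrow>
        ({x. u x \<ge> t} - cball 0 (r t)) \<union> (cball 0 (r t) - {x. u x \<ge> t}) \<in> null_sets lebesgue))"

definition W_integrand :: "('a::euclidean_space \<Rightarrow> real) \<Rightarrow> 'a \<Rightarrow> real" where
  "W_integrand u x = (if grad u x = 0 then 0 else
     norm (grad u x) * \<bar>divg (\<lambda>y. grad u y /\<^sub>R norm (grad u y)) x\<bar> ^ (DIM('a) - 1))"

definition W :: "'a::euclidean_space set \<Rightarrow> ('a \<Rightarrow> real) \<Rightarrow> ennreal" where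
  "W \<Omega> u = (if C2c \<Omega> u then
      ennreal (1 / real (DIM('a) - 1) ^ (DIM('a) - 1)) * (\<integral>\<^sup>+ x. ennreal (W_integrand u x) \<partial>lebesgue)
    else \<infinity>)"

(* L^1(Omega)-lower semicontinuous envelope of W *)
definition Wbar :: "('a::euclidean_space \<Rightarrow> real) \<Rightarrow> 'a set \<Rightarrow> ennreal" where
  "Wbar u \<Omega> = Inf {liminf (\<lambda>n. W \<Omega> (f n)) | f :: nat \<Rightarrow> 'a \<Rightarrow> real.
      (\<forall>n. integrable (lebesgue_on \<Omega>) (f n)) \<and>
      (\<lambda>n. \<integral> x. \<bar>f n x - u x\<bar> \<partial>(lebesgue_on \<Omega>)) \<longlonglongrightarrow> 0}"

definition Fen :: "'a::euclidean_space set \<Rightarrow> real \<Rightarrow> ('a \<Rightarrow> real) \<Rightarrow> ('a \<Rightarrow> real) \<Rightarrow> ennreal" where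
  "Fen \<Omega> \<tau> u0 u = Wbar u \<Omega> + ennreal (1 / (2 * \<tau>) * (\<integral> x. \<bar>u x - u0 x\<bar> \<partial>lebesgue)\<^sup>2)"

end

theory Submission
  imports Defs
begin

text \<open>
  With \<open>c = |S\<^sup>d\<^sup>-\<^sup>1|\<close>, the relaxed functional of \<open>u\<close> is at least \<open>c * ess sup u\<close>, with equality for radially
  non-increasing functions. Hence no rearrangement is needed: if \<open>M = ess sup u\<close> is finite, then
  \<open>v = min u0 M\<close> is radially non-increasing, has relaxed energy at most \<open>c * M\<close>, and is pointwise
  at least as close to \<open>u0\<close> as \<open>u\<close> is; if \<open>M\<close> is infinite, \<open>v = u0\<close> works.

  For the lower bound let \<open>u\<close> be smooth and \<open>n = - grad u / |grad u|\<close>. The map \<open>x \<mapsto> u(x)\<^sup>1\<^sup>/\<^sup>d n(x)\<close>,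
  restricted to the points where the superlevel set of \<open>u\<close> lies on one side of its tangent hyperplane, covers
  almost all of the ball of radius \<open>(max u)\<^sup>1\<^sup>/\<^sup>d\<close>. At such points the shape operator of the level set is
  positive semidefinite, so by the arithmetic-geometric mean inequality the Jacobian of the map is at most
  \<open>1/d\<close> times the integrand of \<open>W\<close> (up to the normalising constant).
\<close>

section \<open>Determinants and traces of endomorphisms of a Euclidean space\<close>

text \<open>Why only the height counts: on a sphere of radius r the curvature factor r^(1-d) cancels
  the area factor r^(d-1), so every layer of a radial profile costs the same, whatever its radius.
  Lowering the top is therefore what saves energy. The exponent 1/d lets a single change of
  variables treat all levels at once. Along the normal the map stretches by |grad u| u^(1/d-1) / d,
  across it by u^(1/d) times the principal curvatures, and the powers of u cancel in the product.
  The restriction to one-sided points is forced by signs: the integrand knows only the sum of the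
  principal curvatures, which controls their product only if none is negative. The price is the
  covering statement, and its obstacle is that a furthest point of a superlevel set may be critical,
  where no normal exists. Relaxation does not spoil the lower bound: a sequence converging to u in
  L^1 must eventually exceed, somewhere, any given m below the essential supremum. In the other
  direction, superposed smooth radial steps of total height slightly above M, supported strictly
  inside the ball, approximate the truncated function.\<close>

text \<open>
  The change of variables theorems are only available for \<open>real^'n\<close>; this type provides an index type
  with \<open>DIM('a)\<close> elements, so that they can be transported to \<open>'a\<close>.
\<close>

typedef (overloaded) 'a dim = "{..<DIM('a::euclidean_space)}"
  morphisms nat_of_dim dim_of_nat
  using DIM_positive by blast

text \<open>Both the determinant formula for triangular matrices and the change of variables
  theorems ask for a well-ordered index type.\<close>

instantiation dim :: (euclidean_space) wellorder
begin

definition less_eq_dim :: "'a dim \<Rightarrow> 'a dim \<Rightarrow> bool"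
  where "i \<le> j \<longleftrightarrow> nat_of_dim i \<le> nat_of_dim j"

definition less_dim :: "'a dim \<Rightarrow> 'a dim \<Rightarrow> bool"
  where "i < j \<longleftrightarrow> nat_of_dim i < nat_of_dim j"

instance
proof
  fix P :: "'a dim \<Rightarrow> bool" and a
  assume step: "\<And>x. (\<And>y. y < x \<Longrightarrow> P y) \<Longrightarrow> P x"
  show "P a"
    by (induction "nat_of_dim a" arbitrary: a rule: less_induct) (metis less_dim_def step)
qed (auto simp: less_eq_dim_def less_dim_def nat_of_dim_inject)

end

lemma range_nat_of_dim: "range (nat_of_dim :: 'a::euclidean_space dim \<Rightarrow> nat) = {..<DIM('a)}"
  by (rule type_definition.Rep_range[OF type_definition_dim])

instance dim :: (euclidean_space) finite
proof
  have "inj (nat_of_dim :: 'a dim \<Rightarrow> nat)"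
    by (simp add: inj_on_def nat_of_dim_inject)
  then show "finite (UNIV :: 'a dim set)"
    using finite_imageD[of nat_of_dim "UNIV :: 'a dim set"] range_nat_of_dim[where 'a='a] by simp
qed

lemma card_dim: "CARD('a::euclidean_space dim) = DIM('a)"
proof -
  have "inj (nat_of_dim :: 'a dim \<Rightarrow> nat)"
    by (simp add: inj_on_def nat_of_dim_inject)
  then show ?thesis
    using card_image[of "nat_of_dim :: 'a dim \<Rightarrow> nat" UNIV] by (simp add: range_nat_of_dim)
qed

text \<open>Since the index type has exactly \<open>DIM('a)\<close> elements, an orthonormal family
  indexed by it is automatically complete.\<close>

definition orthobasis :: "('a::euclidean_space dim \<Rightarrow> 'a) \<Rightarrow> bool" where
  "orthobasis e \<longleftrightarrow> (\<forall>i j. e i \<bullet> e j = (if i = j then 1 else 0))"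

text \<open>Orthogonality gives independence, and the cardinality then gives spanning; hence the
  difference of the two sides, being orthogonal to every \<open>e i\<close>, vanishes.\<close>

lemma orthobasis_coords:
  assumes "orthobasis (e :: 'a::euclidean_space dim \<Rightarrow> 'a)"
  shows "(\<Sum>i\<in>UNIV. (x \<bullet> e i) *\<^sub>R e i) = x"
proof -
  have inj: "inj e"
    using assms unfolding orthobasis_def inj_def by (metis zero_neq_one)
  have "e i \<noteq> 0" for i
    using assms unfolding orthobasis_def by (metis inner_zero_left zero_neq_one)
  then have ind: "independent (range e)"
    using assms by (intro pairwise_orthogonal_independent)
      (auto simp: pairwise_def orthogonal_def orthobasis_def split: if_splits)
  have "card (range e) = DIM('a)"
    by (simp add: card_image inj card_dim)
  then have "span (range e) = UNIV"
    using ind by (metis dim_eq_card_independent dim_eq_full)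
  then have eq: "y = 0" if "\<And>i. y \<bullet> e i = 0" for y
    by (metis (no_types, lifting) UNIV_I inner_commute orthogonal_def orthogonal_self orthogonal_to_span rangeE that)
  have "(x - (\<Sum>i\<in>UNIV. (x \<bullet> e i) *\<^sub>R e i)) \<bullet> e j = 0" for j
    using assms by (simp add: inner_diff_left inner_sum_left orthobasis_def if_distrib[of "(*) _"] cong: if_cong)
  then show ?thesis
    using eq by fastforce
qed

lemma orthobasis_inner:
  assumes "orthobasis (e :: 'a::euclidean_space dim \<Rightarrow> 'a)"
  shows "x \<bullet> y = (\<Sum>i\<in>UNIV. (x \<bullet> e i) * (y \<bullet> e i))"
proof -
  have "x \<bullet> y = (\<Sum>i\<in>UNIV. (x \<bullet> e i) *\<^sub>R e i) \<bullet> y"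
    by (simp add: orthobasis_coords[OF assms])
  then show ?thesis
    by (simp add: inner_sum_left) (simp add: inner_commute)
qed

definition basis_of_dim :: "'a::euclidean_space dim \<Rightarrow> 'a" where
  "basis_of_dim = (SOME f. bij_betw f UNIV Basis)"

lemma bij_basis_of_dim: "bij_betw (basis_of_dim :: 'a dim \<Rightarrow> 'a::euclidean_space) UNIV Basis"
proof -
  have "\<exists>f :: 'a dim \<Rightarrow> 'a. bij_betw f UNIV Basis"
    by (simp add: finite_same_card_bij card_dim)
  then show ?thesis
    unfolding basis_of_dim_def by (rule someI_ex)
qed

lemma orthobasis_basis_of_dim: "orthobasis (basis_of_dim :: 'a::euclidean_space dim \<Rightarrow> 'a)"
  using bij_basis_of_dim[where 'a='a] unfolding orthobasis_def bij_betw_def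
  by (metis inj_onD inner_Basis rangeI UNIV_I)

definition matrix_in :: "('a::euclidean_space dim \<Rightarrow> 'a) \<Rightarrow> ('a \<Rightarrow> 'a) \<Rightarrow> real^'a dim^'a dim" where
  "matrix_in e L = (\<chi> i j. e i \<bullet> L (e j))"

text \<open>The matrix of inner products between two orthonormal bases is orthogonal. This is the
  common source of the basis independence of determinant and trace.\<close>

lemma matrix_in_change_basis:
  fixes e f :: "'a::euclidean_space dim \<Rightarrow> 'a"
  assumes e: "orthobasis e" and f: "orthobasis f" and L: "linear L"
  obtains Q where "transpose Q ** Q = mat 1" "matrix_in e L = transpose Q ** matrix_in f L ** Q"
proof
  define Q :: "real^'a dim^'a dim" where "Q = (\<chi> i j. f i \<bullet> e j)"
  show "transpose Q ** Q = mat 1"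
    using e by (simp add: vec_eq_iff matrix_matrix_mult_def transpose_def mat_def Q_def inner_commute[of "f _"]
        flip: orthobasis_inner[OF f]) (simp add: orthobasis_def)
  have Lf: "f k \<bullet> L x = (\<Sum>l\<in>UNIV. (f k \<bullet> L (f l)) * (f l \<bullet> x))" for k x
    by (subst orthobasis_coords[OF f, of x, symmetric])
      (simp add: linear_sum[OF L] linear_scale[OF L] inner_sum_right inner_commute mult.commute)
  have "e i \<bullet> L (e j) = (\<Sum>k\<in>UNIV. (\<Sum>l\<in>UNIV. (f l \<bullet> e i) * (f l \<bullet> L (f k))) * (f k \<bullet> e j))" for i j
  proof -
    have "e i \<bullet> L (e j) = (\<Sum>l\<in>UNIV. (f l \<bullet> e i) * (\<Sum>k\<in>UNIV. (f l \<bullet> L (f k)) * (f k \<bullet> e j)))"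
      by (subst orthobasis_inner[OF f]) (simp add: inner_commute[of "e i"] inner_commute[of "L (e j)"] flip: Lf)
    also have "\<dots> = (\<Sum>k\<in>UNIV. (\<Sum>l\<in>UNIV. (f l \<bullet> e i) * (f l \<bullet> L (f k))) * (f k \<bullet> e j))"
      by (simp add: sum_distrib_left sum_distrib_right mult.assoc) (rule sum.swap)
    finally show ?thesis .
  qed
  then show "matrix_in e L = transpose Q ** matrix_in f L ** Q"
    by (simp add: vec_eq_iff matrix_matrix_mult_def transpose_def Q_def matrix_in_def)
qed

definition edet :: "('a::euclidean_space \<Rightarrow> 'a) \<Rightarrow> real" where
  "edet L = det (matrix_in basis_of_dim L)"

lemma edet_orthobasis:
  assumes "orthobasis e" "linear L"
  shows "edet L = det (matrix_in e L)"
proof -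
  obtain Q where Q: "transpose Q ** Q = mat 1"
    "matrix_in e L = transpose Q ** matrix_in basis_of_dim L ** Q"
    using matrix_in_change_basis[OF assms(1) orthobasis_basis_of_dim assms(2)] .
  have "det (transpose Q) * det Q = 1"
    by (metis Q(1) det_I det_mul)
  then show ?thesis
    by (simp add: Q(2) edet_def det_mul)
qed

lemma trace_orthobasis:
  assumes "orthobasis e" "linear L"
  shows "(\<Sum>i\<in>UNIV. e i \<bullet> L (e i)) = (\<Sum>b\<in>Basis. L b \<bullet> b)"
proof -
  obtain Q where Q: "transpose Q ** Q = mat 1"
    "matrix_in e L = transpose Q ** matrix_in basis_of_dim L ** Q"
    using matrix_in_change_basis[OF assms(1) orthobasis_basis_of_dim assms(2)] .
  have "Q ** transpose Q = mat 1"
    using Q(1) matrix_left_right_inverse by blast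
  then have "trace (matrix_in e L) = trace (matrix_in basis_of_dim L)"
    by (metis Q(2) matrix_mul_assoc matrix_mul_lid trace_mul_sym)
  moreover have "trace (matrix_in basis_of_dim L) = (\<Sum>b\<in>Basis. L b \<bullet> b)"
    using sum.reindex_bij_betw[OF bij_basis_of_dim, of "\<lambda>b. L b \<bullet> b"]
    by (simp add: trace_def matrix_in_def inner_commute)
  ultimately show ?thesis
    by (simp add: trace_def matrix_in_def)
qed

text \<open>A maximiser of the quadratic form on the unit sphere of \<open>V\<close> is an
  eigenvector, and its orthogonal complement in \<open>V\<close> is again invariant. The statement
  is relative to \<open>V\<close> because it will be applied to a shape operator, which is symmetric
  on the tangent hyperplane but possibly not on the whole space.\<close>

lemma spectral_on_subspace:
  fixes C :: "'a::euclidean_space \<Rightarrow> 'a"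
  assumes "linear C" "subspace V" "\<And>x. x \<in> V \<Longrightarrow> C x \<in> V"
    and "\<And>x y. x \<in> V \<Longrightarrow> y \<in> V \<Longrightarrow> x \<bullet> C y = y \<bullet> C x"
  shows "\<exists>E. E \<subseteq> V \<and> pairwise orthogonal E \<and> (\<forall>e\<in>E. norm e = 1 \<and> C e = (e \<bullet> C e) *\<^sub>R e) \<and> V \<subseteq> span E"
  using assms(2-)
proof (induction "dim V" arbitrary: V rule: less_induct)
  case less
  note V = \<open>subspace V\<close> and inv = less.prems(2) and sym = less.prems(3)
  show ?case
  proof (cases "V \<subseteq> {0}")
    case True
    then show ?thesis by (intro exI[of _ "{}"]) auto
  next
    case False
    then obtain v where v: "v \<in> V" "v \<noteq> 0" by auto
    have "compact (V \<inter> sphere 0 1)"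
      by (simp add: closed_Int_compact closed_subspace V)
    moreover have "v /\<^sub>R norm v \<in> V \<inter> sphere 0 1"
      using v V by (simp add: subspace_scale)
    moreover have "continuous_on (V \<inter> sphere 0 1) (\<lambda>x. x \<bullet> C x)"
      by (intro continuous_intros linear_continuous_on) (use assms(1) linear_conv_bounded_linear in blast)
    ultimately obtain e where e: "e \<in> V" "norm e = 1"
      and max: "\<And>x. x \<in> V \<Longrightarrow> norm x = 1 \<Longrightarrow> x \<bullet> C x \<le> e \<bullet> C e"
      using continuous_attains_sup[of "V \<inter> sphere 0 1" "\<lambda>x. x \<bullet> C x"] by (metis (no_types, lifting) Int_iff empty_iff mem_sphere_0)
    \<comment> \<open>\<open>q\<close> is nonnegative on \<open>V\<close> and vanishes at the
      maximiser \<open>e\<close>, so its first variation at \<open>e\<close> must vanish; this is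
      the eigenvector equation.\<close>
    define q where "q y = (e \<bullet> C e) * (y \<bullet> y) - y \<bullet> C y" for y
    have q_nonneg: "0 \<le> q y" if "y \<in> V" for y
    proof (cases "y = 0")
      case False
      have "(y /\<^sub>R norm y) \<bullet> C (y /\<^sub>R norm y) \<le> e \<bullet> C e"
        using False that V by (intro max) (simp_all add: subspace_scale)
      then show ?thesis
        using False by (simp add: q_def linear_scale[OF assms(1)] field_simps power2_eq_square flip: power2_norm_eq_inner)
    qed (simp add: q_def)
    have q_expand: "q (e + t *\<^sub>R h) = 2 * t * ((e \<bullet> C e) * (e \<bullet> h) - h \<bullet> C e) + t\<^sup>2 * q h"
      if "h \<in> V" for t h
    proof -
      have "e \<bullet> e = 1" using e by (simp add: norm_eq_1)
      then show ?thesis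
        using sym[OF that e(1)]
        by (simp add: q_def linear_add[OF assms(1)] linear_scale[OF assms(1)] inner_add_left inner_add_right
            inner_commute[of h e] algebra_simps power2_eq_square)
    qed
    have orth: "h \<bullet> C e = (e \<bullet> C e) * (e \<bullet> h)" if h: "h \<in> V" for h
    proof (rule ccontr)
      assume neq: "\<not> ?thesis"
      define a where "a = (e \<bullet> C e) * (e \<bullet> h) - h \<bullet> C e"
      have a: "a \<noteq> 0" using neq by (simp add: a_def)
      \<comment> \<open>The step \<open>- a / s\<close> is well defined even if
        \<open>q h = 0\<close>, and short enough for the linear term to dominate the quadratic
        one.\<close>
      define s where "s = q h + 1"
      have s: "s > 0" "q h = s - 1" using q_nonneg[OF h] by (simp_all add: s_def)
      have "0 \<le> q (e + (- a / s) *\<^sub>R h)"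
        using h e V by (intro q_nonneg) (simp add: subspace_add subspace_diff subspace_scale)
      then have "0 \<le> 2 * (- a / s) * a + (- a / s)\<^sup>2 * q h"
        by (simp only: q_expand[OF h] a_def)
      moreover have "2 * (- a / s) * a + (- a / s)\<^sup>2 * q h = - (a\<^sup>2 * (s + 1) / s\<^sup>2)"
        using s(1) unfolding s(2) by (simp add: divide_simps power2_eq_square) (simp add: algebra_simps)
      moreover have "0 < a\<^sup>2 * (s + 1) / s\<^sup>2"
        using a s by (intro divide_pos_pos mult_pos_pos) auto
      ultimately show False by linarith
    qed
    have eig: "C e = (e \<bullet> C e) *\<^sub>R e"
    proof -
      \<comment> \<open>The residual of the eigenvector equation lies in \<open>V\<close> and can be
        tested against itself.\<close>
      define w where "w = C e - (e \<bullet> C e) *\<^sub>R e"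
      have "w \<in> V"
        using e inv V by (simp add: w_def subspace_diff subspace_scale)
      then have "w \<bullet> (C e - (e \<bullet> C e) *\<^sub>R e) = 0"
        using orth by (simp only: inner_diff_right inner_scaleR_right inner_commute[of e w])
      then show ?thesis by (simp flip: w_def) (simp add: w_def)
    qed
    define V' where "V' = {x \<in> V. e \<bullet> x = 0}"
    have "subspace V'"
      using V unfolding subspace_def V'_def by (auto simp: inner_add_right)
    moreover have "C x \<in> V'" if "x \<in> V'" for x
      using that sym[of e x] e eig inv unfolding V'_def
      by (metis (mono_tags, lifting) inner_commute inner_scaleR_right mem_Collect_eq mult_zero_right)
    moreover have "x \<bullet> C y = y \<bullet> C x" if "x \<in> V'" "y \<in> V'" for x y
      using that sym by (simp add: V'_def)
    moreover have "dim V' < dim V"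
    proof (rule dim_psubset)
      have "e \<notin> V'" using e by (auto simp: V'_def)
      moreover have "V' \<subseteq> V" by (auto simp: V'_def)
      ultimately show "span V' \<subset> span V"
        using e V \<open>subspace V'\<close> by (metis psubsetI span_eq_iff)
    qed
    ultimately obtain E where E: "E \<subseteq> V'" "pairwise orthogonal E" "V' \<subseteq> span E"
      "\<And>x. x \<in> E \<Longrightarrow> norm x = 1 \<and> C x = (x \<bullet> C x) *\<^sub>R x"
      using less.hyps[of V'] by blast
    show ?thesis
    proof (intro exI[of _ "insert e E"] conjI ballI)
      show "insert e E \<subseteq> V" using e E by (auto simp: V'_def)
      show "pairwise orthogonal (insert e E)"
        using E by (auto simp: pairwise_insert V'_def orthogonal_def inner_commute)
      show "V \<subseteq> span (insert e E)"
      proof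
        fix x assume x: "x \<in> V"
        have "x - (e \<bullet> x) *\<^sub>R e \<in> V'"
          using x e V by (simp add: V'_def subspace_diff subspace_scale inner_diff_right norm_eq_1)
        then have "x - (e \<bullet> x) *\<^sub>R e \<in> span (insert e E)"
          using E(3) span_mono[of E "insert e E"] by blast
        then show "x \<in> span (insert e E)"
          by (metis insertI1 span_base span_breakdown_eq span_redundant)
      qed
    qed (use e eig E in auto)
  qed
qed

text \<open>The arithmetic-geometric mean inequality with natural powers. A vanishing product is
  split off because the passage between \<open>powr\<close> and powers needs a positive
  base.\<close>

lemma prod_le_mean_power:
  fixes f :: "'i \<Rightarrow> real"
  assumes "finite S" "S \<noteq> {}" "\<And>i. i \<in> S \<Longrightarrow> 0 \<le> f i"
  shows "(\<Prod>i\<in>S. f i) \<le> ((\<Sum>i\<in>S. f i) / card S) ^ card S"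
proof -
  have n: "card S > 0" using assms by (simp add: card_gt_0_iff)
  have mean: "0 \<le> (\<Sum>i\<in>S. f i) / card S"
    using assms by (simp add: sum_nonneg)
  show ?thesis
  proof (cases "(\<Prod>i\<in>S. f i) = 0")
    case False
    then have pos: "(\<Prod>i\<in>S. f i) > 0"
      using assms by (simp add: order_le_neq_trans[OF prod_nonneg])
    have "(\<Prod>i\<in>S. f i) = ((\<Prod>i\<in>S. f i) powr (1 / card S)) ^ card S"
      using pos n by (simp add: powr_powr flip: powr_realpow)
    also have "\<dots> \<le> ((\<Sum>i\<in>S. f i) / card S) ^ card S"
      using arith_geom_mean[of S f] assms by (intro power_mono) (auto simp: sum_divide_distrib)
    finally show ?thesis .
  qed (use mean in simp)
qed

text \<open>Any enumeration of \<open>E\<close> can be composed with a transposition that brings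
  \<open>n\<close> to the prescribed index; this control of the position is what produces a
  triangular matrix later.\<close>

lemma orthobasis_of_set:
  fixes E :: "'a::euclidean_space set"
  assumes "pairwise orthogonal E" "\<And>e. e \<in> E \<Longrightarrow> norm e = 1" "span E = UNIV" "n \<in> E"
  obtains e :: "'a dim \<Rightarrow> 'a" where "orthobasis e" "range e = E" "e i0 = n"
proof -
  have "0 \<notin> E"
    using assms(2)[of 0] by auto
  then have "independent E"
    using assms(1) by (intro pairwise_orthogonal_independent)
  then have "finite E" "card E = DIM('a)"
    using assms(3) by (auto simp: independent_imp_finite) (metis dim_eq_card_independent dim_eq_full)
  then obtain f :: "'a dim \<Rightarrow> 'a" where f: "bij_betw f UNIV E"
    using finite_same_card_bij[of "UNIV :: 'a dim set" E] by (auto simp: card_dim)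
  then obtain i1 where i1: "f i1 = n"
    using assms(4) by (metis bij_betw_def imageE)
  define e where "e = f \<circ> Transposition.transpose i0 i1"
  have bij: "bij_betw e UNIV E"
    unfolding e_def by (rule bij_betw_trans[OF bij_transpose f])
  have "orthobasis e"
    unfolding orthobasis_def
  proof (intro allI)
    fix i j
    have "e i \<in> E" "e j \<in> E" "e i = e j \<longleftrightarrow> i = j"
      using bij unfolding bij_betw_def by (blast, blast, metis inj_eq)
    then show "e i \<bullet> e j = (if i = j then 1 else 0)"
      using assms(1) assms(2)[of "e i"] unfolding pairwise_def orthogonal_def norm_eq_1 by auto
  qed
  moreover have "range e = E" "e i0 = n"
    using bij i1 by (simp_all add: bij_betw_def e_def)
  ultimately show ?thesis ..
qed

text \<open>Complete \<open>n\<close> by eigenvectors of \<open>B\<close> in its orthogonal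
  hyperplane. In this basis \<open>L\<close> is triangular, with diagonal entries
  \<open>- \<beta>\<close> and \<open>\<gamma>\<close> times the eigenvalues of \<open>B\<close>; it
  need not be diagonal, since \<open>B n\<close> may have a tangential part. The eigenvalues are
  nonnegative, so their product is at most the corresponding power of their mean.\<close>

lemma edet_le:
  fixes B L :: "'a::euclidean_space \<Rightarrow> 'a"
  assumes d: "DIM('a) \<ge> 2" and n: "norm n = 1" and lin: "linear B" "linear L"
    and orth: "\<And>h. n \<bullet> B h = 0"
    and sym: "\<And>h k. n \<bullet> h = 0 \<Longrightarrow> n \<bullet> k = 0 \<Longrightarrow> h \<bullet> B k = k \<bullet> B h"
    and psd: "\<And>h. n \<bullet> h = 0 \<Longrightarrow> 0 \<le> h \<bullet> B h"
    and nonneg: "0 \<le> \<beta>" "0 \<le> \<gamma>"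
    and L: "\<And>h. L h = \<gamma> *\<^sub>R B h - (\<beta> * (n \<bullet> h)) *\<^sub>R n"
  shows "\<bar>edet L\<bar> \<le> \<beta> * \<gamma> ^ (DIM('a) - 1) *
    ((\<Sum>b\<in>Basis. B b \<bullet> b) / real (DIM('a) - 1)) ^ (DIM('a) - 1)"
proof -
  define V where "V = {h. n \<bullet> h = 0}"
  have "subspace V"
    by (simp add: V_def subspace_hyperplane)
  then obtain E where E: "E \<subseteq> V" "pairwise orthogonal E" "V \<subseteq> span E"
    "\<And>e. e \<in> E \<Longrightarrow> norm e = 1 \<and> B e = (e \<bullet> B e) *\<^sub>R e"
    using spectral_on_subspace[of B V] lin orth sym by (auto simp: V_def)
  have nn: "n \<bullet> n = 1" using n by (simp add: norm_eq_1)
  have n_notin: "n \<notin> E" using E(1) nn by (auto simp: V_def)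
  have sp: "span (insert n E) = UNIV"
  proof -
    have "x \<in> span (insert n E)" for x
    proof -
      have "x - (n \<bullet> x) *\<^sub>R n \<in> V"
        by (simp add: V_def inner_diff_right nn)
      then show ?thesis
        using E(3) by (metis span_breakdown_eq subsetD)
    qed
    then show ?thesis by blast
  qed
  have po: "pairwise orthogonal (insert n E)"
    using E(1,2) by (auto simp: pairwise_insert V_def orthogonal_def inner_commute)
  have "norm x = 1" if "x \<in> insert n E" for x
    using that E(4) n by auto
  then obtain e :: "'a dim \<Rightarrow> 'a" where e: "orthobasis e" "range e = insert n E" "e (LEAST i. True) = n"
    using orthobasis_of_set[OF po _ sp insertI1, where ?i0.0 = "LEAST i. True"] by blast
  \<comment> \<open>\<open>n\<close> gets the least index, which makes the matrix of \<open>L\<close> lower triangular\<close>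
  define i0 :: "'a dim" where "i0 = (LEAST i. True)"
  have i0_le: "i0 \<le> i" for i by (simp add: i0_def Least_le)
  have ei0: "e i0 = n" using e(3) by (simp add: i0_def)
  have inj: "e i = e j \<longleftrightarrow> i = j" for i j
    using e(1) unfolding orthobasis_def by (metis zero_neq_one)
  have eE: "e i \<in> E" if "i \<noteq> i0" for i
    using that e(2) ei0 inj by (metis insertE rangeI)
  have ee: "e i \<bullet> e j = (if i = j then 1 else 0)" for i j
    using e(1) by (simp add: orthobasis_def)
  have n_e: "n \<bullet> e i = (if i = i0 then 1 else 0)" for i
    using ee[of i0 i] by (auto simp: ei0)
  have Be: "B (e i) = (e i \<bullet> B (e i)) *\<^sub>R e i" if "i \<noteq> i0" for i
    using E(4) eE[OF that] by blast
  have "matrix_in e L $ i $ j = 0" if "i < j" for i j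
  proof -
    have j: "j \<noteq> i0" using i0_le[of i] that by auto
    have "e i \<bullet> B (e j) = 0"
      using that by (subst Be[OF j]) (simp add: ee)
    then show ?thesis
      using j by (simp add: matrix_in_def L inner_diff_right n_e)
  qed
  then have "det (matrix_in e L) = (\<Prod>i\<in>UNIV. matrix_in e L $ i $ i)"
    by (rule det_lowerdiagonal)
  also have "\<dots> = (- \<beta>) * (\<Prod>i\<in>UNIV-{i0}. \<gamma> * (e i \<bullet> B (e i)))"
    by (subst prod.remove[of _ i0])
      (auto simp: matrix_in_def L inner_diff_right n_e ei0 orth nn intro!: arg_cong2[of _ _ _ _ "(*)"] prod.cong)
  finally have det: "edet L = (- \<beta>) * (\<gamma> ^ (DIM('a) - 1) * (\<Prod>i\<in>UNIV-{i0}. e i \<bullet> B (e i)))"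
    by (simp add: edet_orthobasis[OF e(1) lin(2)] prod.distrib card_Diff_singleton card_dim)
  have pos: "0 \<le> e i \<bullet> B (e i)" if "i \<noteq> i0" for i
    using that by (intro psd) (simp add: n_e)
  have card: "card (UNIV - {i0}) = DIM('a) - 1"
    by (simp add: card_Diff_singleton card_dim)
  \<comment> \<open>The full trace is basis independent, and the diagonal entry of \<open>B\<close>
    at \<open>n\<close> is zero.\<close>
  have "(\<Sum>i\<in>UNIV-{i0}. e i \<bullet> B (e i)) = (\<Sum>b\<in>Basis. B b \<bullet> b)"
    using trace_orthobasis[OF e(1) lin(1)] sum.remove[of UNIV i0 "\<lambda>i. e i \<bullet> B (e i)"]
    by (simp add: ei0 orth)
  moreover have "(\<Prod>i\<in>UNIV-{i0}. e i \<bullet> B (e i))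
      \<le> ((\<Sum>i\<in>UNIV-{i0}. e i \<bullet> B (e i)) / card (UNIV - {i0})) ^ card (UNIV - {i0})"
  proof (rule prod_le_mean_power)
    show "UNIV - {i0} \<noteq> {}" using card d by (metis One_nat_def card.empty diff_is_0_eq not_less_eq_eq numeral_2_eq_2)
  qed (use pos in auto)
  ultimately have "(\<Prod>i\<in>UNIV-{i0}. e i \<bullet> B (e i))
      \<le> ((\<Sum>b\<in>Basis. B b \<bullet> b) / real (DIM('a) - 1)) ^ (DIM('a) - 1)"
    by (simp only: card)
  moreover have "0 \<le> (\<Prod>i\<in>UNIV-{i0}. e i \<bullet> B (e i))"
    using pos by (intro prod_nonneg) auto
  moreover have "\<bar>edet L\<bar> = \<beta> * \<gamma> ^ (DIM('a) - 1) * (\<Prod>i\<in>UNIV-{i0}. e i \<bullet> B (e i))"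
    using nonneg \<open>0 \<le> (\<Prod>i\<in>UNIV-{i0}. e i \<bullet> B (e i))\<close> by (simp add: det abs_mult)
  ultimately show ?thesis
    using nonneg by (simp add: mult_left_mono)
qed

section \<open>Change of variables transported to an abstract Euclidean space\<close>

definition to_vec :: "'a::euclidean_space \<Rightarrow> real^'a dim" where
  "to_vec x = (\<chi> i. x \<bullet> basis_of_dim i)"

definition of_vec :: "real^'a dim \<Rightarrow> 'a::euclidean_space" where
  "of_vec y = (\<Sum>i\<in>UNIV. (y $ i) *\<^sub>R basis_of_dim i)"

lemma of_vec_to_vec [simp]: "of_vec (to_vec x) = x"
  by (simp add: of_vec_def to_vec_def orthobasis_coords[OF orthobasis_basis_of_dim])

lemma of_vec_inner_basis: "of_vec y \<bullet> basis_of_dim i = y $ i"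
  using orthobasis_basis_of_dim[where 'a='a]
  by (simp add: of_vec_def inner_sum_left orthobasis_def if_distrib[of "(*) _"] cong: if_cong)

lemma to_vec_of_vec [simp]: "to_vec (of_vec y) = y"
  by (simp add: to_vec_def of_vec_inner_basis)

lemma linear_to_vec: "linear to_vec"
  by (rule linearI) (simp_all add: to_vec_def vec_eq_iff inner_add_left)

lemma linear_of_vec: "linear of_vec"
  by (rule linearI) (simp_all add: of_vec_def scaleR_left_distrib sum.distrib scaleR_sum_right)

lemma of_vec_axis: "of_vec (axis i 1) = basis_of_dim i"
  by (simp add: of_vec_def axis_def if_distrib[of "\<lambda>c. c *\<^sub>R _"] cong: if_cong)

lemma of_vec_vimage: "of_vec -` S = to_vec ` S"
  by (auto simp: image_iff) (metis to_vec_of_vec)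

lemma det_matrix_of_vec: "det (matrix (to_vec \<circ> L \<circ> of_vec)) = edet L"
  by (simp add: edet_def matrix_def matrix_in_def of_vec_axis) (simp add: to_vec_def inner_commute)

text \<open>Because \<open>basis_of_dim\<close> enumerates \<open>Basis\<close>, coordinates turn
  boxes into boxes with the same side lengths, and boxes determine Lebesgue measure.\<close>

lemma lborel_distr_of_vec: "distr lborel borel of_vec = (lborel :: 'a::euclidean_space measure)"
proof (rule sym, rule lborel_eqI)
  have cont: "continuous_on UNIV (of_vec :: _ \<Rightarrow> 'a)"
    using linear_of_vec by (intro linear_continuous_on) (simp add: linear_conv_bounded_linear)
  fix l u :: 'a
  assume le: "\<And>b. b \<in> Basis \<Longrightarrow> l \<bullet> b \<le> u \<bullet> b"
  have bas: "basis_of_dim i \<in> (Basis :: 'a set)" for i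
    using bij_basis_of_dim by (auto simp: bij_betw_def)
  have Basis_eq: "(Basis :: 'a set) = range basis_of_dim"
    using bij_basis_of_dim by (auto simp: bij_betw_def)
  have vim: "of_vec -` box l u = box (to_vec l) (to_vec u)"
    by (auto simp: mem_box_cart mem_box Basis_eq to_vec_def of_vec_inner_basis)
  have "emeasure (distr lborel borel of_vec) (box l u) = emeasure lborel (of_vec -` box l u)"
    using cont by (subst emeasure_distr) (auto intro: borel_measurable_continuous_onI)
  also have "\<dots> = (\<Prod>i\<in>UNIV. (to_vec u - to_vec l) $ i)"
  proof -
    have le': "to_vec l \<bullet> b \<le> to_vec u \<bullet> b" if "b \<in> Basis" for b
      using that le bas by (auto simp: Basis_vec_def inner_axis to_vec_def)
    have "(\<Prod>b\<in>Basis. (to_vec u - to_vec l) \<bullet> b) = (\<Prod>i\<in>UNIV. (to_vec u - to_vec l) $ i)"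
      by (simp add: Basis_vec_def UNION_singleton_eq_range prod.reindex inj_on_def axis_eq_axis inner_axis)
    then show ?thesis
      using le' by (simp add: vim emeasure_lborel_box)
  qed
  also have "(\<Prod>i\<in>UNIV. (to_vec u - to_vec l) $ i) = (\<Prod>b\<in>Basis. (u - l) \<bullet> b)"
    using prod.reindex_bij_betw[OF bij_basis_of_dim, of "\<lambda>b. (u - l) \<bullet> b"]
    by (simp add: to_vec_def inner_diff_left)
  finally show "emeasure (distr lborel borel of_vec) (box l u) = (\<Prod>b\<in>Basis. (u - l) \<bullet> b)" .
qed simp

text \<open>The area inequality, which allows overlaps in the image. The Jacobian is only known to
  be measurable; its integrability comes from the continuous majorant \<open>b\<close> on the
  compact set \<open>S\<close>.\<close>

lemma emeasure_image_le:
  fixes \<Phi> :: "'a::euclidean_space \<Rightarrow> 'a"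
  assumes S: "compact S"
    and deriv: "\<And>x. x \<in> S \<Longrightarrow> (\<Phi> has_derivative \<Phi>' x) (at x within S)"
    and b: "continuous_on S b" "\<And>x. x \<in> S \<Longrightarrow> \<bar>edet (\<Phi>' x)\<bar> \<le> b x"
  shows "emeasure lborel (\<Phi> ` S) \<le> (\<integral>\<^sup>+x. ennreal (indicator S x * b x) \<partial>lborel)"
proof -
  define g where "g = to_vec \<circ> \<Phi> \<circ> of_vec"
  define g' where "g' y = to_vec \<circ> \<Phi>' (of_vec y) \<circ> of_vec" for y
  define S' where "S' = to_vec ` S"
  have bl: "bounded_linear (to_vec :: 'a \<Rightarrow> _)" "bounded_linear (of_vec :: _ \<Rightarrow> 'a)"
    using linear_to_vec linear_of_vec by (simp_all add: linear_conv_bounded_linear)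
  have cont: "continuous_on UNIV (to_vec :: 'a \<Rightarrow> _)" "continuous_on UNIV (of_vec :: _ \<Rightarrow> 'a)"
    using bl linear_continuous_on by blast+
  have meas: "of_vec \<in> borel \<rightarrow>\<^sub>M (borel :: 'a measure)"
    using cont(2) by (rule borel_measurable_continuous_onI)
  have S': "compact S'"
    unfolding S'_def
    using S continuous_on_subset[OF cont(1) subset_UNIV] by (rule compact_continuous_image[rotated])
  then have leb: "S' \<in> sets lebesgue"
    by (simp add: compact_imp_closed borel_closed lebesgue_closedin)
  have deriv': "(g has_derivative g' y) (at y within S')" if "y \<in> S'" for y
  proof -
    have y: "of_vec y \<in> S" "of_vec ` S' = S" using that by (auto simp: S'_def image_image)
    have "(of_vec has_derivative of_vec) (at y within S')"
      using bl(2) bounded_linear_imp_has_derivative by blast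
    then have "((\<lambda>y. \<Phi> (of_vec y)) has_derivative (\<lambda>h. \<Phi>' (of_vec y) (of_vec h))) (at y within S')"
      by (rule has_derivative_in_compose) (use deriv y in simp)
    then show ?thesis
      using bounded_linear.has_derivative[OF bl(1)] by (simp add: comp_def g_def g'_def)
  qed
  have det: "det (matrix (g' y)) = edet (\<Phi>' (of_vec y))" for y
    unfolding g'_def by (rule det_matrix_of_vec)
  have cont_b: "continuous_on S' (\<lambda>y. b (of_vec y))"
    using cont(2) by (intro continuous_on_compose2[OF b(1)]) (auto simp: S'_def intro: continuous_on_subset)
  have int_b: "(\<lambda>y. b (of_vec y)) integrable_on S'"
    using integrable_on_lborel[OF borel_integrable_compact[OF S' cont_b]]
    by (subst (asm) indicator_scaleR_eq_if) (rule integrable_restrict_UNIV[THEN iffD1])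
  have le: "\<bar>det (matrix (g' y))\<bar> \<le> b (of_vec y)" if "y \<in> S'" for y
    unfolding det using b(2)[of "of_vec y"] that by (auto simp: S'_def)
  have int: "(\<lambda>y. \<bar>det (matrix (g' y))\<bar>) integrable_on S'"
  proof (rule measurable_bounded_by_integrable_imp_integrable)
    show "(\<lambda>y. \<bar>det (matrix (g' y))\<bar>) \<in> borel_measurable (lebesgue_on S')"
      using borel_measurable_det_Jacobian[OF leb deriv'] by (rule borel_measurable_abs)
    show "norm \<bar>det (matrix (g' y))\<bar> \<le> b (of_vec y)" if "y \<in> S'" for y
      using le[OF that] by simp
  qed (rule int_b leb)+
  have mem: "y \<in> S' \<longleftrightarrow> of_vec y \<in> S" for y
    unfolding S'_def by (metis imageE image_eqI of_vec_to_vec to_vec_of_vec)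
  have img: "g ` S' = of_vec -` (\<Phi> ` S)"
    by (simp add: S'_def g_def of_vec_vimage image_image)
  have "continuous_on S \<Phi>"
    using deriv by (rule has_derivative_continuous_on)
  then have comp: "compact (\<Phi> ` S)"
    using S by (rule compact_continuous_image)
  have "emeasure lborel (\<Phi> ` S) = emeasure (distr lborel borel of_vec) (\<Phi> ` S)"
    by (simp add: lborel_distr_of_vec)
  also have "\<dots> = emeasure lborel (g ` S')"
    unfolding img using comp meas by (simp add: emeasure_distr borel_compact)
  also have "\<dots> = emeasure lebesgue (g ` S')"
  proof -
    have "compact (to_vec ` \<Phi> ` S)"
      using comp continuous_on_subset[OF cont(1) subset_UNIV] by (rule compact_continuous_image[rotated])
    then have "g ` S' \<in> sets lborel"
      unfolding img of_vec_vimage by (simp add: borel_compact)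
    moreover have "emeasure lborel K = emeasure lebesgue K" if "K \<in> sets lborel" for K :: "(real^'a dim) set"
      using that by simp
    ultimately show ?thesis by blast
  qed
  also have "\<dots> = measure lebesgue (g ` S')"
    using measurable_differentiable_image[OF leb deriv' int] by (rule emeasure_eq_measure2)
  also have "\<dots> \<le> ennreal (integral S' (\<lambda>y. b (of_vec y)))"
  proof (rule ennreal_leI)
    show "measure lebesgue (g ` S') \<le> integral S' (\<lambda>y. b (of_vec y))"
      using measure_differentiable_image[OF leb deriv' int] integral_le[OF int int_b le] by linarith
  qed
  also have "\<dots> = (\<integral>\<^sup>+y. ennreal (indicator S' y * b (of_vec y)) \<partial>lborel)"
  proof -
    have "0 \<le> b (of_vec y)" if "y \<in> S'" for y
      using le[OF that] by linarith
    then show ?thesis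
      by (intro nn_integral_has_integral_lebesgue[symmetric] integrable_integral int_b)
  qed
  also have "\<dots> = (\<integral>\<^sup>+y. ennreal (indicator S (of_vec y) * b (of_vec y)) \<partial>lborel)"
    by (simp add: indicator_def mem)
  also have "\<dots> = (\<integral>\<^sup>+x. ennreal (indicator S x * b x) \<partial>distr lborel borel of_vec)"
  proof -
    have "(\<lambda>x. indicator S x *\<^sub>R b x) \<in> borel_measurable borel"
      using S b(1) by (intro borel_measurable_continuous_on_indicator) (auto simp: borel_compact)
    then have "(\<lambda>x. ennreal (indicator S x * b x)) \<in> borel_measurable borel"
      by simp
    then show ?thesis
      using nn_integral_distr[of of_vec lborel borel "\<lambda>x. ennreal (indicator S x * b x)"] meas
      by simp
  qed
  finally show ?thesis
    unfolding lborel_distr_of_vec .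
qed

section \<open>Two criteria for null sets\<close>

text \<open>A substitute for polar coordinates: apply Fubini to the pairs \<open>(c, x)\<close> with
  \<open>c *\<^sub>R x\<close> in \<open>N\<close>. The sections in \<open>c\<close> are null, so
  for almost every \<open>c\<close> in \<open>{1..2}\<close> the set \<open>N\<close> shrunk by
  \<open>c\<close> is null, and one such \<open>c\<close> suffices.\<close>

lemma null_if_radial_sections_null:
  fixes N :: "'a::euclidean_space set"
  assumes N: "N \<in> sets borel"
    and sec: "\<And>x. {c \<in> {1..2::real}. c *\<^sub>R x \<in> N} \<in> null_sets lborel"
  shows "N \<in> null_sets lborel"
proof -
  define E where "E = {p :: real \<times> 'a. fst p \<in> {1..2} \<and> fst p *\<^sub>R snd p \<in> N}"
  have "(\<lambda>p :: real \<times> 'a. fst p *\<^sub>R snd p) \<in> borel_measurable borel"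
    by (intro borel_measurable_continuous_onI continuous_intros)
  moreover have "(fst :: real \<times> 'a \<Rightarrow> real) \<in> borel_measurable borel"
    by (intro borel_measurable_continuous_onI continuous_intros)
  ultimately have "(fst -` {1..2} \<inter> (\<lambda>p. fst p *\<^sub>R snd p) -` N :: (real \<times> 'a) set) \<in> sets borel"
    using N by (auto intro!: sets.Int measurable_sets_borel)
  then have E_borel: "E \<in> sets (borel \<Otimes>\<^sub>M borel)"
    unfolding borel_prod E_def by (simp add: vimage_def Int_def)
  then have E: "E \<in> sets (lborel \<Otimes>\<^sub>M lborel)"
    by (metis sets_lborel sets_pair_measure_cong)
  have "(\<integral>\<^sup>+c. emeasure lborel (Pair c -` E) \<partial>lborel) = emeasure (lborel \<Otimes>\<^sub>M lborel) E"
    by (rule lborel.emeasure_pair_measure_alt[symmetric, OF E])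
  also have "\<dots> = (\<integral>\<^sup>+x. emeasure lborel ((\<lambda>c. (c, x)) -` E) \<partial>lborel)"
    by (rule lborel_pair.emeasure_pair_measure_alt2[OF E])
  also have "\<dots> = 0"
    using sec by (simp add: E_def null_sets_def vimage_def)
  finally have "AE c in lborel. emeasure lborel (Pair c -` E) = 0"
    by (subst (asm) nn_integral_0_iff_AE) (rule lborel.measurable_emeasure_Pair[OF E])
  \<comment> \<open>Only an interval of positive length guarantees that "almost every
    \<open>c\<close>" includes a \<open>c\<close> in \<open>{1..2}\<close>; for other
    \<open>c\<close> the section is empty and says nothing.\<close>
  moreover have "\<not> (AE c in lborel. c \<notin> {1..2::real})"
  proof
    assume "AE c in lborel. c \<notin> {1..2::real}"
    then have "{1..2::real} \<in> null_sets lborel"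
      by (subst (asm) AE_iff_null) (simp_all add: Collect_conj_eq flip: atLeast_def atMost_def atLeastAtMost_def)
    then show False by (simp add: null_sets_def)
  qed
  ultimately have "\<exists>c\<in>{1..2::real}. emeasure lborel (Pair c -` E) = 0"
    by (metis (mono_tags, lifting) AE_mp AE_I2)
  then obtain c :: real where c: "c \<in> {1..2}" "emeasure lborel (Pair c -` E) = 0"
    by blast
  have "Pair c -` E \<in> sets lborel"
    using sets_Pair1[OF E_borel] by simp
  then have "negligible (Pair c -` E)"
    using c(2) by (simp add: negligible_iff_null_sets null_sets_completionI null_setsI)
  then have "negligible ((*\<^sub>R) c ` (Pair c -` E))"
    by (intro negligible_differentiable_image_negligible) (auto intro!: derivative_intros)
  moreover have "(*\<^sub>R) c ` (Pair c -` E) = N"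
  proof -
    have "x \<in> (*\<^sub>R) c ` (Pair c -` E)" if "x \<in> N" for x
      using that c(1) by (intro image_eqI[of _ _ "x /\<^sub>R c"]) (auto simp: E_def)
    then show ?thesis
      by (auto simp: E_def)
  qed
  ultimately show ?thesis
    using N by (simp add: negligible_iff_null_sets null_sets_completion_iff)
qed

text \<open>Cut \<open>{a..b}\<close> into \<open>N\<close> pieces of width \<open>w\<close>. The
  points of \<open>T\<close> whose value of \<open>s\<close> lies in one piece are within a multiple
  of the square of \<open>w\<close> of each other, so \<open>N\<close> intervals of total length of
  order \<open>1 / N\<close> cover \<open>T\<close>.\<close>

lemma negligible_of_quadratic_bound:
  fixes T :: "real set" and s :: "real \<Rightarrow> real"
  assumes range: "\<And>t. t \<in> T \<Longrightarrow> s t \<in> {a..b}"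
    and bound: "\<And>t t'. t \<in> T \<Longrightarrow> t' \<in> T \<Longrightarrow> \<bar>t - t'\<bar> \<le> C * (s t - s t')\<^sup>2"
  shows "negligible T"
  unfolding negligible_outer_le
proof (intro allI impI)
  fix e :: real assume "e > 0"
  \<comment> \<open>The added 1 makes \<open>s t - a < L\<close> strict, so the index of the piece
    stays below \<open>N\<close>.\<close>
  define L where "L = \<bar>b - a\<bar> + 1"
  define D where "D = \<bar>C\<bar> + 1"
  have pos: "L > 0" "D > 0" by (simp_all add: L_def D_def)
  obtain N :: nat where N: "2 * D * L\<^sup>2 / e < N"
    using reals_Archimedean2 by blast
  have Npos: "N > 0"
    using N pos \<open>e > 0\<close> by (metis divide_nonneg_pos less_le_not_le linorder_not_less mult_nonneg_nonneg
        of_nat_0_less_iff order_less_imp_le order_le_less_trans zero_le_numeral zero_le_power2)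
  define w where "w = L / N"
  have w: "w > 0" using pos Npos by (simp add: w_def)
  define r where "r = D * w\<^sup>2"
  define T' where "T' k = {t \<in> T. a + k * w \<le> s t \<and> s t \<le> a + (k + 1) * w}" for k :: nat
  \<comment> \<open>For an empty piece the centre is arbitrary; its interval is counted in the bound
    anyway.\<close>
  define f where "f k = (SOME t. t \<in> T' k)" for k
  define U where "U = (\<Union>k<N. cball (f k) r)"
  have "T \<subseteq> U"
  proof
    fix t assume t: "t \<in> T"
    define x where "x = (s t - a) * N / L"
    define k where "k = nat \<lfloor>x\<rfloor>"
    have "0 \<le> s t - a" "s t - a < L"
      using range[OF t] by (auto simp: L_def)
    moreover have "(s t - a) * N < L * N"
      using calculation(2) Npos by simp
    ultimately have x: "0 \<le> x" "x < N"
      using pos Npos by (simp_all add: x_def pos_divide_less_eq mult.commute)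
    then have k: "k \<le> x" "x \<le> k + 1" "k < N"
      by (simp_all add: k_def) linarith+
    have "s t = a + x * w"
      using pos Npos by (simp add: x_def w_def)
    then have "t \<in> T' k"
      using k(1,2) t w unfolding T'_def by (simp add: mult_right_mono)
    then have fk: "f k \<in> T' k"
      unfolding f_def by (rule someI)
    have "\<bar>s (f k) - s t\<bar> \<le> w"
      using fk \<open>t \<in> T' k\<close> by (auto simp: T'_def algebra_simps abs_le_iff)
    then have sq: "(s (f k) - s t)\<^sup>2 \<le> w\<^sup>2"
      by (simp add: abs_le_square_iff[symmetric])
    have "\<bar>f k - t\<bar> \<le> C * (s (f k) - s t)\<^sup>2"
      using fk t by (intro bound) (auto simp: T'_def)
    also have "\<dots> \<le> D * (s (f k) - s t)\<^sup>2"
      by (intro mult_right_mono) (auto simp: D_def)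
    also have "\<dots> \<le> r"
      unfolding r_def using sq pos by (intro mult_left_mono) auto
    finally show "t \<in> U"
      using k(3) by (auto simp: U_def dist_real_def)
  qed
  moreover have "U \<in> lmeasurable"
    unfolding U_def by (intro fmeasurable.finite_UN) auto
  moreover have "measure lebesgue U \<le> e"
  proof -
    have "measure lebesgue U \<le> (\<Sum>k<N. measure lebesgue (cball (f k) r))"
      unfolding U_def by (intro measure_UNION_le) auto
    also have "\<dots> = (\<Sum>k<N. 2 * r)"
      using pos by (intro sum.cong refl) (simp add: cball_eq_atLeastAtMost r_def)
    also have "\<dots> = 2 * D * L\<^sup>2 / N"
      using Npos by (simp add: r_def w_def power2_eq_square)
    also have "\<dots> \<le> e"
      using N Npos \<open>e > 0\<close> by (simp add: field_simps)
    finally show ?thesis .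
  qed
  ultimately show "\<exists>U. T \<subseteq> U \<and> U \<in> lmeasurable \<and> measure lebesgue U \<le> e"
    by blast
qed

section \<open>Gradient and Hessian\<close>

lemma grad_has_derivative:
  assumes "u differentiable at x"
  shows "(u has_derivative (\<lambda>h. grad u x \<bullet> h)) (at x)"
proof -
  have lin: "linear (frechet_derivative u (at x))"
    using assms by (rule linear_frechet_derivative)
  have "frechet_derivative u (at x) h = grad u x \<bullet> h" for h
  proof -
    have "frechet_derivative u (at x) h = frechet_derivative u (at x) (\<Sum>i\<in>Basis. (h \<bullet> i) *\<^sub>R i)"
      by (simp add: euclidean_representation)
    also have "\<dots> = grad u x \<bullet> h"
      by (simp add: linear_sum[OF lin] linear_scale[OF lin] grad_def inner_sum_left)
        (simp add: inner_commute mult.commute)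
    finally show ?thesis .
  qed
  then have "frechet_derivative u (at x) = (\<lambda>h. grad u x \<bullet> h)"
    by blast
  then show ?thesis
    using assms unfolding frechet_derivative_works by simp
qed

lemma grad_eqI:
  assumes "(u has_derivative (\<lambda>h. g \<bullet> h)) (at x)"
  shows "grad u x = g"
  unfolding grad_def frechet_derivative_at[OF assms, symmetric] by (rule euclidean_representation)

lemma deriv_along_line:
  assumes "\<And>y. (u has_derivative (\<lambda>h. G y \<bullet> h)) (at (y :: 'a::real_inner))"
  shows "((\<lambda>s. u (x + s *\<^sub>R h)) has_real_derivative G (x + s *\<^sub>R h) \<bullet> h) (at s within S)"
proof -
  have "((\<lambda>s. x + s *\<^sub>R h) has_derivative (\<lambda>t. 0 + t *\<^sub>R h)) (at s within S)"
    by (intro derivative_intros)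
  then have "((\<lambda>s. x + s *\<^sub>R h) has_derivative (\<lambda>t. t *\<^sub>R h)) (at s within S)"
    by simp
  then have "((\<lambda>s. u (x + s *\<^sub>R h)) has_derivative (\<lambda>t. G (x + s *\<^sub>R h) \<bullet> (t *\<^sub>R h))) (at s within S)"
    by (rule has_derivative_compose) (rule assms)
  then show ?thesis
    by (rule has_derivative_imp_has_field_derivative) (simp add: mult.commute)
qed

text \<open>The mean value theorem in direction \<open>h\<close> turns the second difference into a
  difference of two gradients, and both are compared with their linearisation at \<open>x\<close>.
  Since the second difference is symmetric in \<open>h\<close> and \<open>k\<close>, so is its
  limit, which gives the symmetry of the Hessian.\<close>

lemma second_difference_limit:
  fixes u :: "'a::real_inner \<Rightarrow> real"
  assumes G: "\<And>y. (u has_derivative (\<lambda>h. G y \<bullet> h)) (at y)"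
    and H: "(G has_derivative H) (at x)" and "e > 0"
  shows "\<exists>\<delta>>0. \<forall>t. 0 < t \<and> t < \<delta> \<longrightarrow>
    \<bar>u (x + t *\<^sub>R h + t *\<^sub>R k) - u (x + t *\<^sub>R h) - u (x + t *\<^sub>R k) + u x - t\<^sup>2 * (H k \<bullet> h)\<bar> \<le> e * t\<^sup>2"
proof -
  define M where "M = norm h + norm k + 1"
  have M: "M > 0" "norm h \<le> M" by (simp_all add: M_def add_nonneg_pos)
  \<comment> \<open>Two remainders of size at most \<open>e' * (t * M)\<close>, multiplied by
    \<open>t\<close> and by \<open>norm h \<le> M\<close>, add up to \<open>e\<close> times the
    square of \<open>t\<close>.\<close>
  define e' where "e' = e / (2 * M\<^sup>2)"
  have e': "e' > 0" using M \<open>e > 0\<close> by (simp add: e'_def)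
  have lin: "linear H" using H by (rule has_derivative_linear)
  obtain d where d: "d > 0" "\<And>y. norm (y - x) < d \<Longrightarrow> norm (G y - G x - H (y - x)) \<le> e' * norm (y - x)"
    using conjunct2[OF H[unfolded has_derivative_at_alt], rule_format, OF e'] by blast
  show ?thesis
  proof (intro exI[of _ "d / M"] conjI allI impI)
    show "d / M > 0" using d M by simp
    fix t assume t: "0 < t \<and> t < d / M"
    define \<phi> where "\<phi> s = u ((x + t *\<^sub>R k) + s *\<^sub>R h) - u (x + s *\<^sub>R h)" for s
    have "(\<phi> has_real_derivative (G ((x + t *\<^sub>R k) + s *\<^sub>R h) \<bullet> h - G (x + s *\<^sub>R h) \<bullet> h)) (at s)" for s
      unfolding \<phi>_def by (intro DERIV_diff deriv_along_line G)
    from MVT2[OF conjunct1[OF t] this] obtain s where s: "0 < s" "s < t"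
      and eq: "\<phi> t - \<phi> 0 = t * ((G (x + (t *\<^sub>R k + s *\<^sub>R h)) - G (x + s *\<^sub>R h)) \<bullet> h)"
      unfolding add.assoc inner_diff_left by auto
    have n1: "norm (t *\<^sub>R k + s *\<^sub>R h) \<le> t * M"
    proof -
      have "norm (t *\<^sub>R k + s *\<^sub>R h) \<le> t * norm k + s * norm h"
        using norm_triangle_ineq[of "t *\<^sub>R k" "s *\<^sub>R h"] t s by simp
      also have "\<dots> \<le> t * norm k + t * norm h"
        using s by (simp add: mult_right_mono)
      finally show ?thesis
        using t by (simp add: M_def algebra_simps)
    qed
    have n2: "norm (s *\<^sub>R h) \<le> t * M"
      using s M by (simp add: mult_mono)
    have tM: "t * M < d"
      using t M by (simp add: pos_less_divide_eq)
    define r where "r y = G (x + y) - G x - H y" for y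
    have r: "norm (r y) \<le> e' * (t * M)" if "norm y \<le> t * M" for y
    proof -
      have "norm (r y) \<le> e' * norm y"
        using d(2)[of "x + y"] that tM by (simp add: r_def)
      also have "\<dots> \<le> e' * (t * M)"
        using that e' by (intro mult_left_mono) auto
      finally show ?thesis .
    qed
    have dec: "(G (x + (t *\<^sub>R k + s *\<^sub>R h)) - G (x + s *\<^sub>R h)) =
        r (t *\<^sub>R k + s *\<^sub>R h) - r (s *\<^sub>R h) + t *\<^sub>R H k"
      by (simp add: r_def linear_add[OF lin] linear_scale[OF lin])
    have "\<phi> t - \<phi> 0 - t\<^sup>2 * (H k \<bullet> h) = t * ((r (t *\<^sub>R k + s *\<^sub>R h) - r (s *\<^sub>R h)) \<bullet> h)"
      unfolding eq dec by (simp add: inner_add_left inner_diff_left algebra_simps power2_eq_square)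
    also have "\<bar>\<dots>\<bar> \<le> t * (norm (r (t *\<^sub>R k + s *\<^sub>R h) - r (s *\<^sub>R h)) * norm h)"
      using t by (simp add: abs_mult Cauchy_Schwarz_ineq2)
    also have "\<dots> \<le> t * ((2 * (e' * (t * M))) * M)"
    proof -
      have "norm (r (t *\<^sub>R k + s *\<^sub>R h) - r (s *\<^sub>R h)) \<le> 2 * (e' * (t * M))"
        using r[OF n1] r[OF n2] norm_triangle_ineq4[of "r (t *\<^sub>R k + s *\<^sub>R h)" "r (s *\<^sub>R h)"] by linarith
      then show ?thesis
        using t M e' by (intro mult_left_mono mult_mono) auto
    qed
    also have "\<dots> = e * t\<^sup>2"
      using M by (simp add: e'_def power2_eq_square)
    finally have "\<bar>\<phi> t - \<phi> 0 - t\<^sup>2 * (H k \<bullet> h)\<bar> \<le> e * t\<^sup>2" .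
    moreover have "x + t *\<^sub>R k + t *\<^sub>R h = x + t *\<^sub>R h + t *\<^sub>R k"
      by (simp only: add.assoc add.commute[of "t *\<^sub>R k"])
    ultimately show "\<bar>u (x + t *\<^sub>R h + t *\<^sub>R k) - u (x + t *\<^sub>R h) - u (x + t *\<^sub>R k) + u x - t\<^sup>2 * (H k \<bullet> h)\<bar> \<le> e * t\<^sup>2"
      by (simp add: \<phi>_def)
  qed
qed

lemma hessian_symmetric:
  fixes u :: "'a::real_inner \<Rightarrow> real"
  assumes G: "\<And>y. (u has_derivative (\<lambda>h. G y \<bullet> h)) (at y)"
    and H: "(G has_derivative H) (at x)"
  shows "H k \<bullet> h = H h \<bullet> k"
proof (rule ccontr)
  assume neq: "H k \<bullet> h \<noteq> H h \<bullet> k"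
  define e where "e = \<bar>H k \<bullet> h - H h \<bullet> k\<bar> / 3"
  have e: "e > 0" using neq by (simp add: e_def)
  define D where "D t = u (x + t *\<^sub>R h + t *\<^sub>R k) - u (x + t *\<^sub>R h) - u (x + t *\<^sub>R k) + u x" for t
  obtain d1 where d1: "d1 > 0" "\<And>t. 0 < t \<Longrightarrow> t < d1 \<Longrightarrow> \<bar>D t - t\<^sup>2 * (H k \<bullet> h)\<bar> \<le> e * t\<^sup>2"
    using second_difference_limit[OF G H e, of h k] unfolding D_def by blast
  obtain d2 where d2: "d2 > 0" "\<And>t. 0 < t \<Longrightarrow> t < d2 \<Longrightarrow> \<bar>D t - t\<^sup>2 * (H h \<bullet> k)\<bar> \<le> e * t\<^sup>2"
  proof -
    have "D t = u (x + t *\<^sub>R k + t *\<^sub>R h) - u (x + t *\<^sub>R k) - u (x + t *\<^sub>R h) + u x" for t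
      by (simp add: D_def add.commute add.left_commute)
    then show ?thesis
      using second_difference_limit[OF G H e, of k h] that by metis
  qed
  define t where "t = min d1 d2 / 2"
  have t: "0 < t" "t < d1" "t < d2" using d1 d2 by (auto simp: t_def)
  have "t\<^sup>2 * \<bar>H k \<bullet> h - H h \<bullet> k\<bar> = \<bar>t\<^sup>2 * (H k \<bullet> h) - t\<^sup>2 * (H h \<bullet> k)\<bar>"
    by (simp add: abs_mult flip: right_diff_distrib)
  also have "\<dots> \<le> 2 * (e * t\<^sup>2)"
    using d1(2)[OF t(1,2)] d2(2)[OF t(1,3)] by linarith
  finally have "\<bar>H k \<bullet> h - H h \<bullet> k\<bar> \<le> 2 * e"
    using t(1) by (simp add: mult.commute)
  then show False using e by (simp add: e_def)
qed

text \<open>One factor \<open>norm h\<close> comes from the mean value theorem, the other from the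
  Lipschitz bound on a gradient that vanishes at \<open>x\<close>. A single constant must serve all
  critical points in the ball.\<close>

lemma quadratic_bound_at_critical_point:
  fixes u :: "'a::euclidean_space \<Rightarrow> real"
  assumes "C2 u"
  shows "\<exists>C. \<forall>x h. grad u x = 0 \<and> norm x \<le> R \<and> norm (x + h) \<le> R \<longrightarrow> \<bar>u (x + h) - u x\<bar> \<le> C * (norm h)\<^sup>2"
proof -
  define H where "H y = frechet_derivative (grad u) (at y)" for y
  have G: "(u has_derivative (\<lambda>h. grad u y \<bullet> h)) (at y)" for y
    using assms unfolding C2_def by (intro grad_has_derivative) blast
  have H: "(grad u has_derivative H y) (at y)" for y
    using assms unfolding C2_def H_def frechet_derivative_works[symmetric] by blast
  \<comment> \<open>\<open>C2\<close> provides continuity of the Hessian only vector by vector;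
    summing over \<open>Basis\<close> yields a bound on the operator norm.\<close>
  have "continuous_on (cball 0 R) (\<lambda>y. \<Sum>b\<in>Basis. norm (H y b))"
    using assms continuous_on_subset[OF _ subset_UNIV] unfolding C2_def H_def
    by (intro continuous_on_sum continuous_on_norm) blast
  then have "bounded ((\<lambda>y. \<Sum>b\<in>Basis. norm (H y b)) ` cball 0 R)"
    by (intro compact_imp_bounded compact_continuous_image) auto
  then obtain K where K: "\<And>y. y \<in> cball 0 R \<Longrightarrow> (\<Sum>b\<in>Basis. norm (H y b)) \<le> K"
    unfolding bounded_iff by (metis abs_le_D1 image_eqI real_norm_def)
  have on: "onorm (H y) \<le> K" if "y \<in> cball 0 R" for y
  proof (rule onorm_le)
    fix h
    have lin: "linear (H y)" using H by (rule has_derivative_linear)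
    have "H y h = H y (\<Sum>b\<in>Basis. (h \<bullet> b) *\<^sub>R b)"
      by (simp add: euclidean_representation)
    also have "norm \<dots> \<le> (\<Sum>b\<in>Basis. norm h * norm (H y b))"
      unfolding linear_sum[OF lin] linear_scale[OF lin]
      by (rule sum_norm_le) (simp add: Basis_le_norm mult_right_mono)
    also have "\<dots> \<le> K * norm h"
      using K[OF that] by (simp add: mult.commute[of K] mult_left_mono flip: sum_distrib_left)
    finally show "norm (H y h) \<le> K * norm h" .
  qed
  have "\<bar>u (x + h) - u x\<bar> \<le> K * (norm h)\<^sup>2"
    if x: "grad u x = 0" "norm x \<le> R" "norm (x + h) \<le> R" for x h
  proof -
    have "\<exists>s. 0 < s \<and> s < 1 \<and> u (x + 1 *\<^sub>R h) - u (x + 0 *\<^sub>R h) = (1 - 0) * (grad u (x + s *\<^sub>R h) \<bullet> h)"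
      by (rule MVT2) (auto intro: deriv_along_line G)
    then obtain s where s: "0 < s" "s < 1" "u (x + h) - u x = grad u (x + s *\<^sub>R h) \<bullet> h"
      by auto
    have "(1 - s) *\<^sub>R x + s *\<^sub>R (x + h) \<in> cball 0 R"
      using x s convex_cball[of 0 R] by (intro convexD) auto
    then have mem: "x + s *\<^sub>R h \<in> cball 0 R"
      by (simp add: algebra_simps)
    have "norm (grad u (x + s *\<^sub>R h) - grad u x) \<le> K * norm ((x + s *\<^sub>R h) - x)"
      using x mem on by (intro differentiable_bound[of "cball 0 R" "grad u" H])
        (auto intro: has_derivative_at_withinI[OF H])
    also have "\<dots> \<le> K * norm h"
    proof -
      have "0 \<le> (\<Sum>b\<in>Basis. norm (H x b))" by (simp add: sum_nonneg)
      then have "0 \<le> K" using K[of x] x by simp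
      then show ?thesis using s by (intro mult_left_mono) (auto simp: mult_left_le_one_le)
    qed
    finally have "norm (grad u (x + s *\<^sub>R h)) \<le> K * norm h" using x by simp
    then have "norm (grad u (x + s *\<^sub>R h)) * norm h \<le> K * norm h * norm h"
      by (rule mult_right_mono) simp
    then show ?thesis
      using Cauchy_Schwarz_ineq2[of "grad u (x + s *\<^sub>R h)" h] s(3)
      by (simp add: power2_eq_square mult.assoc)
  qed
  then show ?thesis by blast
qed

text \<open>Extends a bound from an open half-space to its boundary hyperplane, approached along
  rays pointing inwards.\<close>

lemma le_by_ray_limit:
  fixes u :: "'a::real_normed_vector \<Rightarrow> real"
  assumes "isCont u z" "\<And>\<epsilon>. \<epsilon> > 0 \<Longrightarrow> u (z + \<epsilon> *\<^sub>R v) \<le> c"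
  shows "u z \<le> c"
proof -
  have "((\<lambda>\<epsilon>::real. z + \<epsilon> *\<^sub>R v) \<longlongrightarrow> z + 0 *\<^sub>R v) (at_right 0)"
    by (intro tendsto_intros)
  then have "((\<lambda>\<epsilon>::real. u (z + \<epsilon> *\<^sub>R v)) \<longlongrightarrow> u z) (at_right 0)"
    using isCont_tendsto_compose[OF assms(1)] by simp
  moreover have "eventually (\<lambda>\<epsilon>::real. u (z + \<epsilon> *\<^sub>R v) \<le> c) (at_right 0)"
    using eventually_at_right_less[of "0::real"] by eventually_elim (rule assms(2))
  ultimately show ?thesis
    by (rule tendsto_upperbound) simp
qed

lemma directional_derivative_nonpos:
  fixes u :: "'a::real_inner \<Rightarrow> real"
  assumes G: "\<And>y. (u has_derivative (\<lambda>h. G y \<bullet> h)) (at y)"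
    and le: "\<And>s. s > 0 \<Longrightarrow> u (x + s *\<^sub>R h) \<le> u x"
  shows "G x \<bullet> h \<le> 0"
proof (rule ccontr)
  assume "\<not> ?thesis"
  then have "0 < G (x + 0 *\<^sub>R h) \<bullet> h" by simp
  from DERIV_pos_inc_right[OF deriv_along_line[OF G] this] obtain d where
    "d > 0" "\<forall>s>0. s < d \<longrightarrow> u (x + 0 *\<^sub>R h) < u (x + (0 + s) *\<^sub>R h)"
    by blast
  then have "u x < u (x + (d / 2) *\<^sub>R h)" by simp
  then show False using le[of "d / 2"] \<open>d > 0\<close> by simp
qed

text \<open>Were the second derivative positive, the first derivative, which is zero at
  \<open>x\<close>, would be positive just after it, and \<open>u\<close> would increase along the
  line.\<close>

lemma hessian_nonpos_at_line_max:
  fixes u :: "'a::real_inner \<Rightarrow> real"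
  assumes G: "\<And>y. (u has_derivative (\<lambda>h. G y \<bullet> h)) (at y)"
    and H: "(G has_derivative H) (at x)"
    and "G x \<bullet> h = 0" and le: "\<And>s. s > 0 \<Longrightarrow> u (x + s *\<^sub>R h) \<le> u x"
  shows "h \<bullet> H h \<le> 0"
proof (rule ccontr)
  assume "\<not> ?thesis"
  then have pos: "0 < H h \<bullet> h" by (simp add: inner_commute)
  have "((\<lambda>s. x + s *\<^sub>R h) has_derivative (\<lambda>t. 0 + t *\<^sub>R h)) (at 0)"
    by (intro derivative_intros)
  then have "((\<lambda>s. G (x + s *\<^sub>R h)) has_derivative (\<lambda>t. H (0 + t *\<^sub>R h))) (at 0)"
    by (rule has_derivative_compose) (simp add: H)
  then have "((\<lambda>s. G (x + s *\<^sub>R h) \<bullet> h) has_derivative (\<lambda>t. H (0 + t *\<^sub>R h) \<bullet> h)) (at 0)"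
    by (rule has_derivative_inner_left)
  then have "((\<lambda>s. G (x + s *\<^sub>R h) \<bullet> h) has_real_derivative H h \<bullet> h) (at 0)"
    by (rule has_derivative_imp_has_field_derivative)
      (simp add: linear_scale[OF has_derivative_linear[OF H]] mult.commute)
  from DERIV_pos_inc_right[OF this pos] obtain d where
    d: "d > 0" "\<And>s. s > 0 \<Longrightarrow> s < d \<Longrightarrow> 0 < G (x + s *\<^sub>R h) \<bullet> h"
    using assms(3) by auto
  have "\<exists>s. 0 < s \<and> s < d / 2 \<and> u (x + (d / 2) *\<^sub>R h) - u (x + 0 *\<^sub>R h) = (d / 2 - 0) * (G (x + s *\<^sub>R h) \<bullet> h)"
    by (rule MVT2) (use d(1) in \<open>auto intro: deriv_along_line G\<close>)
  then obtain s where s: "0 < s" "s < d / 2" "u (x + (d / 2) *\<^sub>R h) - u x = (d / 2) * (G (x + s *\<^sub>R h) \<bullet> h)"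
    by auto
  have "0 < (d / 2) * (G (x + s *\<^sub>R h) \<bullet> h)"
    using d s by simp
  then show False
    using s(3) le[of "d / 2"] d(1) by simp
qed

text \<open>The second term removes from \<open>H h /\<^sub>R norm (G x)\<close> its component along
  \<open>G x\<close>: a field of unit vectors varies orthogonally to itself.\<close>

lemma normalized_has_derivative:
  fixes G :: "'a::real_inner \<Rightarrow> 'a"
  assumes H: "(G has_derivative H) (at x)" and "G x \<noteq> 0"
  shows "((\<lambda>y. G y /\<^sub>R norm (G y)) has_derivative
    (\<lambda>h. H h /\<^sub>R norm (G x) - ((G x \<bullet> H h) / norm (G x) ^ 3) *\<^sub>R G x)) (at x)"
proof -
  have "((\<lambda>y. norm (G y)) has_derivative (\<lambda>h. H h \<bullet> sgn (G x))) (at x)"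
    using has_derivative_compose[OF H has_derivative_norm[OF assms(2)]] by (simp add: inner_commute)
  then have "((\<lambda>y. inverse (norm (G y))) has_derivative
      (\<lambda>h. - (inverse (norm (G x)) * (H h \<bullet> sgn (G x)) * inverse (norm (G x))))) (at x)"
    using assms(2) by (intro Deriv.has_derivative_inverse) auto
  from has_derivative_scaleR[OF this H] show ?thesis
    by (rule has_derivative_eq_rhs)
      (simp add: fun_eq_iff sgn_div_norm field_simps power3_eq_cube inner_commute)
qed

section \<open>The contact set and its image\<close>

text \<open>
  Since \<open>- grad u x\<close> is the outer normal of the superlevel set at \<open>x\<close>, the condition on \<open>y\<close> says that
  \<open>y\<close> lies strictly beyond the tangent hyperplane at \<open>x\<close>.
\<close>

definition contact :: "('a::euclidean_space \<Rightarrow> real) \<Rightarrow> 'a \<Rightarrow> bool" where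
  "contact u x \<longleftrightarrow> (\<forall>y. grad u x \<bullet> (y - x) < 0 \<longrightarrow> u y \<le> u x)"

text \<open>The thresholds keep away from the zeros of \<open>u\<close>, where the root is not
  differentiable, and from critical points, where the normal is undefined. They are closed
  conditions and are relaxed as \<open>k\<close> grows.\<close>

definition contact_set :: "('a::euclidean_space \<Rightarrow> real) \<Rightarrow> real \<Rightarrow> nat \<Rightarrow> 'a set" where
  "contact_set u R k =
    {x \<in> cball 0 R. 1 / Suc k \<le> u x \<and> 1 / Suc k \<le> norm (grad u x) \<and> contact u x}"

definition level_normal_map :: "('a::euclidean_space \<Rightarrow> real) \<Rightarrow> 'a \<Rightarrow> 'a" where
  "level_normal_map u x = - (root DIM('a) (u x) *\<^sub>R (grad u x /\<^sub>R norm (grad u x)))"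

text \<open>Read for one fixed \<open>y\<close> at a time, the contact condition is a disjunction of
  two closed conditions on \<open>x\<close>.\<close>

lemma compact_contact_set:
  assumes "continuous_on UNIV u" "continuous_on UNIV (grad u)"
  shows "compact (contact_set u R k)"
proof -
  have "contact_set u R k = cball 0 R \<inter> {x. 1 / Suc k \<le> u x} \<inter> {x. 1 / Suc k \<le> norm (grad u x)} \<inter>
      (\<Inter>y. {x. 0 \<le> grad u x \<bullet> (y - x) \<or> u y \<le> u x})"
    by (auto simp: contact_set_def contact_def not_less[symmetric])
  moreover have "closed {x. 0 \<le> grad u x \<bullet> (y - x) \<or> u y \<le> u x}" for y
    by (intro closed_Collect_disj closed_Collect_le continuous_intros assms)
  ultimately show ?thesis
    using assms
    by (auto intro!: compact_Int_closed closed_Collect_le continuous_intros closed_INT)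
qed

lemma C2_facts:
  assumes "C2 u"
  shows "(u has_derivative (\<lambda>h. grad u x \<bullet> h)) (at x)"
    and "(grad u has_derivative frechet_derivative (grad u) (at x)) (at x)"
    and "continuous_on UNIV u" "continuous_on UNIV (grad u)"
    and "continuous_on UNIV (\<lambda>x. frechet_derivative (grad u) (at x) v)"
  using assms unfolding C2_def
  by (auto intro: grad_has_derivative differentiable_imp_continuous_within continuous_at_imp_continuous_on
      simp flip: frechet_derivative_works)

text \<open>The derivative of the map has the shape treated in \<open>edet_le\<close>. Its
  hypotheses on \<open>B\<close> are that normals vary tangentially, that the Hessian is symmetric,
  and that contact makes the level set curve one way.\<close>

lemma emeasure_level_normal_map_le:
  fixes u :: "'a::euclidean_space \<Rightarrow> real"
  assumes u: "C2 u" and d2: "DIM('a) \<ge> 2"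
  shows "emeasure lborel (level_normal_map u ` contact_set u R k) \<le>
    ennreal (1 / (real DIM('a) * real (DIM('a) - 1) ^ (DIM('a) - 1))) *
      (\<integral>\<^sup>+x. ennreal (W_integrand u x) \<partial>lebesgue)"
proof -
  define d where "d = DIM('a)"
  define H where "H x = frechet_derivative (grad u) (at x)" for x
  note der = C2_facts(1)[OF u] and Hder = C2_facts(2)[OF u, folded H_def]
  note cont = C2_facts(3,4)[OF u] C2_facts(5)[OF u, folded H_def]
  define S where "S = contact_set u R k"
  define g where "g x = root d (u x)" for x
  define n where "n x = - (grad u x /\<^sub>R norm (grad u x))" for x
  \<comment> \<open>The derivative of the outer normal \<open>n\<close>: the shape operator of the
    level set, extended to all directions.\<close>
  define B where "B x h = - (H x h /\<^sub>R norm (grad u x) -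
      ((grad u x \<bullet> H x h) / norm (grad u x) ^ 3) *\<^sub>R grad u x)" for x h
  \<comment> \<open>The length of the gradient of \<open>g\<close>, by the chain rule; that gradient
    points along \<open>- n\<close>, whence the sign in \<open>L\<close>.\<close>
  define \<beta> where "\<beta> x = inverse (real d * g x ^ (d - 1)) * norm (grad u x)" for x
  define L where "L x h = g x *\<^sub>R B x h - (\<beta> x * (n x \<bullet> h)) *\<^sub>R n x" for x h
  define b where "b x = W_integrand u x / (real d * real (d - 1) ^ (d - 1))" for x
  define c where "c = 1 / (real d * real (d - 1) ^ (d - 1))"
  have c0: "c \<noteq> 0" using d2 by (simp add: c_def d_def)
  have b_c: "b x = c * W_integrand u x" for x by (simp add: b_def c_def)
  have S: "u x > 0" "grad u x \<noteq> 0" "contact u x" if "x \<in> S" for x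
    using that less_le_trans[of 0 "1 / Suc k" "u x"] less_le_trans[of 0 "1 / Suc k" "norm (grad u x)"]
    by (auto simp: S_def contact_set_def)
  have g: "g x > 0" if "x \<in> S" for x
    using S[OF that] by (simp add: g_def d_def)
  have norm_der: "((\<lambda>y. grad u y /\<^sub>R norm (grad u y)) has_derivative (\<lambda>h. - B x h)) (at x)" if "x \<in> S" for x
    using normalized_has_derivative[OF Hder S(2)[OF that]] by (simp add: B_def)
  have lin_B: "linear (B x)" if "x \<in> S" for x
    using has_derivative_linear[OF has_derivative_minus[OF norm_der[OF that]]] by simp
  have div: "divg (\<lambda>y. grad u y /\<^sub>R norm (grad u y)) x = - (\<Sum>i\<in>Basis. B x i \<bullet> i)" if "x \<in> S" for x
    unfolding divg_def frechet_derivative_at[OF norm_der[OF that], symmetric] by (simp add: sum_negf)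
  have b_eq: "b x = norm (grad u x) / d * (\<bar>\<Sum>i\<in>Basis. B x i \<bullet> i\<bar> / real (d - 1)) ^ (d - 1)" if "x \<in> S" for x
    using S(2)[OF that] by (simp add: b_def W_integrand_def div[OF that] d_def power_divide)
  have L_der: "(level_normal_map u has_derivative L x) (at x)" if x: "x \<in> S" for x
  proof -
    have "(g has_derivative (\<lambda>h. (grad u x \<bullet> h) * inverse (real d * g x ^ (d - 1)))) (at x)"
    proof -
      have "(root d has_real_derivative inverse (real d * g x ^ (d - 1))) (at (u x))"
        using S(1)[OF x] DERIV_real_root[of d "u x"] by (simp add: g_def d_def)
      then have "(root d has_derivative (\<lambda>h. h * inverse (real d * g x ^ (d - 1)))) (at (u x))"
        by (rule has_field_derivative_imp_has_derivative[THEN has_derivative_eq_rhs]) (simp only: mult.commute fun_eq_iff simp_thms)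
      from has_derivative_compose[OF der this] show ?thesis
        by (simp only: g_def[abs_def])
    qed
    from has_derivative_minus[OF has_derivative_scaleR[OF this norm_der[OF x]]]
    have A: "(level_normal_map u has_derivative
        (\<lambda>h. - (g x *\<^sub>R - B x h + ((grad u x \<bullet> h) * inverse (real d * g x ^ (d - 1))) *\<^sub>R (grad u x /\<^sub>R norm (grad u x))))) (at x)"
      by (simp only: level_normal_map_def[abs_def] g_def[abs_def] d_def)
    have "- (g x *\<^sub>R - B x h + ((grad u x \<bullet> h) * inverse (real d * g x ^ (d - 1))) *\<^sub>R (grad u x /\<^sub>R norm (grad u x))) = L x h" for h
      using S(2)[OF x] by (simp add: L_def \<beta>_def n_def)
    then show ?thesis
      by (intro has_derivative_eq_rhs[OF A] ext)
  qed
  have edet: "\<bar>edet (L x)\<bar> \<le> b x" if x: "x \<in> S" for x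
  proof -
    have nG: "n x \<bullet> h = 0 \<longleftrightarrow> grad u x \<bullet> h = 0" for h
      using S(2)[OF x] by (simp add: n_def)
    have "\<bar>edet (L x)\<bar> \<le> \<beta> x * g x ^ (DIM('a) - 1) *
        ((\<Sum>i\<in>Basis. B x i \<bullet> i) / real (DIM('a) - 1)) ^ (DIM('a) - 1)"
    proof (rule edet_le[OF d2, of "n x" "B x"])
      show "norm (n x) = 1" using S(2)[OF x] by (simp add: n_def)
      show "linear (L x)" using L_der[OF x] by (rule has_derivative_linear)
      show "n x \<bullet> B x h = 0" for h
        unfolding nG using S(2)[OF x]
        by (simp add: B_def inner_diff_right power3_eq_cube dot_square_norm power2_eq_square field_simps)
      show "h \<bullet> B x k = k \<bullet> B x h" if "n x \<bullet> h = 0" "n x \<bullet> k = 0" for h k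
        using that hessian_symmetric[OF der Hder, of x h k] unfolding nG
        by (simp add: B_def inner_diff_right inner_commute[of _ "grad u x"]) (simp add: inner_commute)
      show "0 \<le> h \<bullet> B x h" if "n x \<bullet> h = 0" for h
      proof -
        have Gh: "grad u x \<bullet> h = 0" using that nG by simp
        \<comment> \<open>Contact speaks of the open half-space only; moving off the tangent
          hyperplane along \<open>- grad u x\<close> reaches it, and a limit brings the bound
          back.\<close>
        have le: "u (x + s *\<^sub>R h) \<le> u x" for s
        proof (rule le_by_ray_limit[where v = "- grad u x"])
          show "isCont u (x + s *\<^sub>R h)" using cont(1) by (simp add: continuous_on_eq_continuous_at)
          show "u (x + s *\<^sub>R h + \<epsilon> *\<^sub>R (- grad u x)) \<le> u x" if "\<epsilon> > 0" for \<epsilon>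
          proof -
            have "grad u x \<bullet> (x + s *\<^sub>R h + \<epsilon> *\<^sub>R (- grad u x) - x) < 0"
              using that S(2)[OF x] Gh by (simp add: inner_diff_right inner_add_right)
            then show ?thesis using S(3)[OF x] unfolding contact_def by blast
          qed
        qed
        have "h \<bullet> H x h \<le> 0"
          by (rule hessian_nonpos_at_line_max[OF der Hder Gh le])
        then show ?thesis
          using Gh by (simp add: B_def inner_diff_right inner_commute[of h "grad u x"] divide_nonpos_nonneg mult_nonneg_nonpos)
      qed
      show "0 \<le> \<beta> x" "0 \<le> g x" using g[OF x] by (simp_all add: \<beta>_def)
      show "L x h = g x *\<^sub>R B x h - (\<beta> x * (n x \<bullet> h)) *\<^sub>R n x" for h by (simp add: L_def)
    qed (use lin_B x in auto)
    also have "\<beta> x * g x ^ (DIM('a) - 1) = norm (grad u x) / d"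
      using g[OF x] by (simp add: \<beta>_def d_def field_simps)
    also have "norm (grad u x) / d * ((\<Sum>i\<in>Basis. B x i \<bullet> i) / real (DIM('a) - 1)) ^ (DIM('a) - 1) \<le> b x"
    proof -
      have "a ^ j \<le> \<bar>a\<bar> ^ j" for a :: real and j
        by (metis abs_ge_self power_abs)
      from this[of "(\<Sum>i\<in>Basis. B x i \<bullet> i) / real (d - 1)" "d - 1"]
      show ?thesis
        unfolding b_eq[OF x] by (intro mult_left_mono) (simp_all add: d_def)
    qed
    finally show ?thesis .
  qed
  \<comment> \<open>On \<open>S\<close> the divergence has been expressed through gradient and
    Hessian, which makes its continuity visible.\<close>
  have "continuous_on S (\<lambda>x. norm (grad u x) / d * (\<bar>\<Sum>i\<in>Basis. B x i \<bullet> i\<bar> / real (d - 1)) ^ (d - 1))"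
    unfolding B_def using S(2) d2
    by (intro continuous_intros continuous_on_subset[OF cont(2)] continuous_on_subset[OF cont(3)]) (auto simp: d_def)
  then have cont_b: "continuous_on S b"
    using b_eq by (simp cong: continuous_on_cong)
  have "emeasure lborel (level_normal_map u ` S) \<le> (\<integral>\<^sup>+x. ennreal (indicator S x * b x) \<partial>lborel)"
    by (rule emeasure_image_le[OF _ has_derivative_at_withinI[OF L_der] cont_b edet])
      (simp add: S_def compact_contact_set cont)
  also have "\<dots> = (\<integral>\<^sup>+x. ennreal c * ennreal (indicator S x * W_integrand u x) \<partial>lborel)"
    by (intro nn_integral_cong, subst ennreal_mult[symmetric])
      (auto simp: b_c W_integrand_def c_def indicator_def)
  \<comment> \<open>The indicator is kept until the constant has been pulled out, since
    measurability is established only for the integrand cut off to \<open>S\<close>.\<close>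
  also have "\<dots> = ennreal c * (\<integral>\<^sup>+x. ennreal (indicator S x * W_integrand u x) \<partial>lborel)"
  proof (rule nn_integral_cmult)
    have "continuous_on S (\<lambda>x. b x / c)"
      using c0 by (intro continuous_intros cont_b) auto
    then have "continuous_on S (W_integrand u)"
      using c0 by (simp add: b_c)
    then have "(\<lambda>x. indicator S x *\<^sub>R W_integrand u x) \<in> borel_measurable borel"
      by (intro borel_measurable_continuous_on_indicator)
        (simp_all add: S_def borel_compact compact_contact_set cont)
    then show "(\<lambda>x. ennreal (indicator S x * W_integrand u x)) \<in> borel_measurable lborel"
      by simp
  qed
  also have "\<dots> = ennreal c * (\<integral>\<^sup>+x. ennreal (indicator S x * W_integrand u x) \<partial>lebesgue)"
    by (subst nn_integral_completion) (rule refl)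
  also have "\<dots> \<le> ennreal c * (\<integral>\<^sup>+x. ennreal (W_integrand u x) \<partial>lebesgue)"
    by (intro mult_left_mono nn_integral_mono ennreal_leI) (simp_all add: indicator_def W_integrand_def)
  finally show ?thesis
    by (simp add: S_def c_def d_def)
qed

text \<open>
  A level \<open>t\<close> is missed in direction \<open>\<nu>\<close> only if the furthest point \<open>X t\<close> of the superlevel set in this
  direction is critical. Among such levels, \<open>t\<close> is a function of \<open>X t \<bullet> \<nu>\<close> with quadratic modulus of
  continuity; this replaces Sard's theorem, which fails for twice differentiable functions if \<open>d > 2\<close>.
\<close>

lemma negligible_uncovered_levels:
  fixes u :: "'a::euclidean_space \<Rightarrow> real"
  assumes u: "C2 u" and R: "\<And>y. u y \<noteq> 0 \<Longrightarrow> norm y \<le> R" and m: "0 < m" "m < u x0"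
    and \<nu>: "norm \<nu> = 1"
  shows "negligible {t \<in> {0<..<m}. \<forall>k. root DIM('a) t *\<^sub>R \<nu> \<notin> level_normal_map u ` contact_set u R k}"
proof -
  define T where "T = {t \<in> {0<..<m}. \<forall>k. root DIM('a) t *\<^sub>R \<nu> \<notin> level_normal_map u ` contact_set u R k}"
  have T: "0 < t" "t < m" "root DIM('a) t *\<^sub>R \<nu> \<notin> level_normal_map u ` contact_set u R k" if "t \<in> T" for t k
    using that by (auto simp: T_def)
  note der = C2_facts(1)[OF u] and cont = C2_facts(3,4)[OF u]
  have isCont: "isCont u z" for z
    using cont(1) by (simp add: continuous_on_eq_continuous_at)
  have \<nu>\<nu>: "\<nu> \<bullet> \<nu> = 1" using \<nu> by (simp add: norm_eq_1)
  have "\<exists>z. t \<le> u z \<and> (\<forall>y. t \<le> u y \<longrightarrow> y \<bullet> \<nu> \<le> z \<bullet> \<nu>)" if t: "t \<in> T" for t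
  proof -
    have "{y. t \<le> u y} \<subseteq> cball 0 R"
    proof
      fix y assume "y \<in> {y. t \<le> u y}"
      then have "u y \<noteq> 0" using T(1)[OF t] by auto
      then show "y \<in> cball 0 R" using R by simp
    qed
    moreover have "closed {y. t \<le> u y}"
      by (intro closed_Collect_le continuous_intros cont)
    ultimately have "compact {y. t \<le> u y}"
      by (meson bounded_cball bounded_subset compact_eq_bounded_closed)
    moreover have "{y. t \<le> u y} \<noteq> {}" using T(2)[OF t] m(2) by (auto intro!: exI[of _ x0])
    moreover have "continuous_on {y. t \<le> u y} (\<lambda>y. y \<bullet> \<nu>)"
      by (intro continuous_intros)
    ultimately show ?thesis
      using continuous_attains_sup[of "{y. t \<le> u y}" "\<lambda>y. y \<bullet> \<nu>"] by auto
  qed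
  note ex = this
  define X where "X t = (SOME z. t \<le> u z \<and> (\<forall>y. t \<le> u y \<longrightarrow> y \<bullet> \<nu> \<le> z \<bullet> \<nu>))" for t
  have X: "t \<le> u (X t)" and Xmax: "\<And>y. t \<le> u y \<Longrightarrow> y \<bullet> \<nu> \<le> X t \<bullet> \<nu>" if "t \<in> T" for t
    using someI_ex[OF ex[OF that], folded X_def] by auto
  have beyond: "u y < t" if "t \<in> T" "X t \<bullet> \<nu> < y \<bullet> \<nu>" for t y
    using Xmax[OF that(1), of y] that(2) by linarith
  have norm_X: "norm (X t) \<le> R" if "t \<in> T" for t
    using X[OF that] T(1)[OF that] by (intro R) linarith
  have uX: "u (X t) = t" if t: "t \<in> T" for t
  \<comment> \<open>Points strictly beyond \<open>X t\<close> in direction \<open>\<nu>\<close> have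
    values below \<open>t\<close>, so continuity excludes a value above \<open>t\<close> at
    \<open>X t\<close> itself.\<close>
  proof (rule antisym)
    show "u (X t) \<le> t"
    proof (rule le_by_ray_limit[where v = \<nu>])
      show "u (X t + \<epsilon> *\<^sub>R \<nu>) \<le> t" if "\<epsilon> > 0" for \<epsilon>
        using that by (intro less_imp_le beyond t) (simp add: inner_add_left \<nu>\<nu>)
    qed (rule isCont)
  qed (rule X[OF t])
  \<comment> \<open>If the gradient were nonzero, maximality would make it a negative multiple of
    \<open>\<nu>\<close>. Then \<open>X t\<close> would be a contact point mapped to the point of
    level \<open>t\<close> in direction \<open>\<nu>\<close>, contradicting
    \<open>t \<in> T\<close>.\<close>
  have crit: "grad u (X t) = 0" if t: "t \<in> T" for t
  proof (rule ccontr)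
    assume G: "grad u (X t) \<noteq> 0"
    define \<gamma> where "\<gamma> = grad u (X t)"
    have dir: "\<gamma> \<bullet> h \<le> 0" if "h \<bullet> \<nu> > 0" for h
      unfolding \<gamma>_def
    proof (rule directional_derivative_nonpos[OF der])
      show "u (X t + s *\<^sub>R h) \<le> u (X t)" if "s > 0" for s
        unfolding uX[OF t] using that \<open>h \<bullet> \<nu> > 0\<close>
        by (intro less_imp_le beyond t) (simp add: inner_add_left)
    qed
    define a where "a = \<gamma> \<bullet> \<nu>"
    \<comment> \<open>The part of the gradient tangential to the supporting hyperplane. Testing with
      \<open>\<tau>\<close> itself, tilted slightly towards \<open>\<nu>\<close> so that
      \<open>dir\<close> applies, shows that it vanishes.\<close>
    define \<tau> where "\<tau> = \<gamma> - a *\<^sub>R \<nu>"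
    have \<tau>\<nu>: "\<tau> \<bullet> \<nu> = 0" by (simp add: \<tau>_def inner_diff_left a_def \<nu>\<nu>)
    have a: "a \<le> 0" using dir[of \<nu>] by (simp add: a_def \<nu>\<nu>)
    have "\<tau> \<bullet> \<tau> + a * \<epsilon> \<le> 0" if "\<epsilon> > 0" for \<epsilon>
    proof -
      have "\<gamma> \<bullet> (\<tau> + \<epsilon> *\<^sub>R \<nu>) \<le> 0"
        using that by (intro dir) (simp add: inner_add_left \<tau>\<nu> \<nu>\<nu>)
      moreover have "\<gamma> = \<tau> + a *\<^sub>R \<nu>" by (simp add: \<tau>_def)
      ultimately show ?thesis
        using \<tau>\<nu> \<nu>\<nu> by (simp add: inner_add_left inner_add_right inner_commute[of \<nu> \<tau>] mult.commute[of a])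
    qed
    have "\<tau> = 0"
    proof (rule ccontr)
      assume "\<tau> \<noteq> 0"
      then have pos: "\<tau> \<bullet> \<tau> > 0" by simp
      \<comment> \<open>Chosen so that \<open>\<tau> \<bullet> \<tau> + a * \<epsilon>\<close>
        equals \<open>\<epsilon>\<close>, which is positive.\<close>
      define \<epsilon> where "\<epsilon> = (\<tau> \<bullet> \<tau>) / (1 - a)"
      have "\<epsilon> > 0" using pos a by (simp add: \<epsilon>_def)
      then have "\<tau> \<bullet> \<tau> + a * \<epsilon> \<le> 0" by fact
      moreover have "\<tau> \<bullet> \<tau> + a * \<epsilon> = \<epsilon>"
        using a by (simp add: \<epsilon>_def field_simps)
      ultimately show False using \<open>\<epsilon> > 0\<close> by simp
    qed
    then have \<gamma>: "\<gamma> = a *\<^sub>R \<nu>" by (simp add: \<tau>_def)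
    have a': "a < 0" using a G \<gamma> by (cases "a = 0") (auto simp: \<gamma>_def)
    have contact: "contact u (X t)"
      unfolding contact_def
    proof (intro allI impI)
      fix y assume "grad u (X t) \<bullet> (y - X t) < 0"
      then have "X t \<bullet> \<nu> < y \<bullet> \<nu>"
        using a' by (simp add: \<gamma>_def[symmetric] \<gamma> mult_less_0_iff inner_diff_right inner_commute[of \<nu>])
      then show "u y \<le> u (X t)"
        using beyond[OF t, of y] uX[OF t] by simp
    qed
    have pos: "0 < min t (norm (grad u (X t)))"
      using T(1)[OF t] G by simp
    obtain k where k: "1 / Suc k < min t (norm (grad u (X t)))"
      using nat_approx_posE[OF pos] by blast
    then have "X t \<in> contact_set u R k"
      using contact norm_X[OF t] uX[OF t] by (simp add: contact_set_def)
    moreover have "level_normal_map u (X t) = root DIM('a) t *\<^sub>R \<nu>"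
      using a' \<nu> by (simp add: level_normal_map_def \<gamma>_def[symmetric] \<gamma> uX[OF t])
    ultimately show False
      using T(3)[OF t, of k] imageI[of "X t" "contact_set u R k" "level_normal_map u"] by simp
  qed
  \<comment> \<open>Points of norm at most \<open>R\<close> will be shifted by at most
    \<open>2 * R\<close>.\<close>
  obtain C where C: "\<And>x h. grad u x = 0 \<Longrightarrow> norm x \<le> 3 * R \<Longrightarrow> norm (x + h) \<le> 3 * R
      \<Longrightarrow> \<bar>u (x + h) - u x\<bar> \<le> C * (norm h)\<^sup>2"
    using quadratic_bound_at_critical_point[OF u, of "3 * R"] by blast
  have R0: "0 \<le> R" using R[of x0] m norm_ge_zero[of x0] by linarith
  have bound: "\<bar>t - t'\<bar> \<le> C * (X t \<bullet> \<nu> - X t' \<bullet> \<nu>)\<^sup>2" if t: "t \<in> T" "t' \<in> T" "t' \<le> t" for t t'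
  proof -
    \<comment> \<open>Shifting \<open>X t\<close> by \<open>r\<close> along \<open>\<nu>\<close>
      puts it on the supporting hyperplane of the larger superlevel set, where \<open>u\<close> is
      at most \<open>t'\<close>. As \<open>X t\<close> is critical, the shift changes
      \<open>u\<close> only quadratically.\<close>
    define r where "r = X t' \<bullet> \<nu> - X t \<bullet> \<nu>"
    have r0: "0 \<le> r"
      using Xmax[OF t(2), of "X t"] X[OF t(1)] t(3) by (simp add: r_def)
    have "u (X t + r *\<^sub>R \<nu>) \<le> t'"
    proof (rule le_by_ray_limit[where v = \<nu>])
      show "u (X t + r *\<^sub>R \<nu> + \<epsilon> *\<^sub>R \<nu>) \<le> t'" if "\<epsilon> > 0" for \<epsilon>
        using that by (intro less_imp_le beyond t) (simp add: inner_add_left \<nu>\<nu> r_def)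
    qed (rule isCont)
    moreover have "\<bar>u (X t + r *\<^sub>R \<nu>) - u (X t)\<bar> \<le> C * (norm (r *\<^sub>R \<nu>))\<^sup>2"
    proof (rule C[OF crit[OF t(1)]])
      show "norm (X t) \<le> 3 * R" using norm_X[OF t(1)] R0 by simp
      have "\<bar>X t' \<bullet> \<nu>\<bar> \<le> R" "\<bar>X t \<bullet> \<nu>\<bar> \<le> R"
        using Cauchy_Schwarz_ineq2[of "X t'" \<nu>] Cauchy_Schwarz_ineq2[of "X t" \<nu>]
          norm_X[OF t(1)] norm_X[OF t(2)] \<nu> by simp_all
      then have "norm (r *\<^sub>R \<nu>) \<le> 2 * R" using \<nu> by (simp add: r_def)
      then show "norm (X t + r *\<^sub>R \<nu>) \<le> 3 * R"
        using norm_triangle_ineq[of "X t" "r *\<^sub>R \<nu>"] norm_X[OF t(1)] by linarith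
    qed
    ultimately have "t - t' \<le> C * r\<^sup>2"
      using \<nu> uX[OF t(1)] by simp
    then show ?thesis
      using t(3) by (simp add: r_def power2_commute)
  qed
  have "negligible T"
  proof (rule negligible_of_quadratic_bound)
    show "X t \<bullet> \<nu> \<in> {-R..R}" if "t \<in> T" for t
      using Cauchy_Schwarz_ineq2[of "X t" \<nu>] norm_X[OF that] \<nu> by (simp add: abs_le_iff)
    show "\<bar>t - t'\<bar> \<le> C * (X t \<bullet> \<nu> - X t' \<bullet> \<nu>)\<^sup>2" if "t \<in> T" "t' \<in> T" for t t'
      using bound[OF that] bound[OF that(2) that(1)]
      by (cases "t' \<le> t") (simp_all add: abs_minus_commute power2_commute)
  qed
  then show ?thesis by (simp only: T_def)
qed

text \<open>In each fixed direction almost every level is covered, and the radial criterion for null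
  sets combines the directions. The lower thresholds of the contact sets disappear in the
  supremum.\<close>

lemma emeasure_ball_le_level_normal_image:
  fixes u :: "'a::euclidean_space \<Rightarrow> real"
  assumes u: "C2 u" and R: "\<And>y. u y \<noteq> 0 \<Longrightarrow> norm y \<le> R" and m: "0 < m" "m < u x0"
  shows "emeasure lborel (ball (0::'a) (root DIM('a) m)) \<le>
    (SUP k. emeasure lborel (level_normal_map u ` contact_set u R k))"
proof -
  define \<rho> where "\<rho> = root DIM('a) m"
  define F where "F k = level_normal_map u ` contact_set u R k" for k
  note cont = C2_facts(3,4)[OF u]
  have F_comp: "compact (F k)" for k
  proof -
    have "1 / Suc k \<le> norm (grad u x)" if "x \<in> contact_set u R k" for x
      using that by (simp add: contact_set_def)
    then have nz: "\<forall>x\<in>contact_set u R k. norm (grad u x) \<noteq> 0"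
      by (metis divide_pos_pos less_le_not_le of_nat_0_less_iff zero_less_Suc zero_less_one)
    have "continuous_on (contact_set u R k) (level_normal_map u)"
      unfolding level_normal_map_def
      by (intro continuous_intros continuous_on_subset[OF cont(1)] continuous_on_subset[OF cont(2)])
        (rule nz subset_UNIV)+
    then show ?thesis
      unfolding F_def by (intro compact_continuous_image compact_contact_set cont)
  qed
  then have F: "F k \<in> sets lborel" for k by (simp add: borel_compact)
  have "incseq F"
  proof (rule incseq_SucI)
    have "1 / real (Suc (Suc k)) \<le> 1 / real (Suc k)" for k by (simp add: frac_le)
    then show "F k \<le> F (Suc k)" for k
      unfolding F_def contact_set_def by (intro image_mono) (auto intro: order_trans)
  qed
  then have sup: "(SUP k. emeasure lborel (F k)) = emeasure lborel (\<Union>k. F k)"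
    using F by (intro SUP_emeasure_incseq) blast+
  \<comment> \<open>The origin has no direction; it is removed here and added back as a null
    set.\<close>
  define N where "N = ball (0::'a) \<rho> - {0} - (\<Union>k. F k)"
  have N: "N \<in> sets borel" using F by (auto simp: N_def)
  have "N \<in> null_sets lborel"
  proof (rule null_if_radial_sections_null[OF N])
    fix x :: 'a
    have meas: "{c \<in> {1..2::real}. c *\<^sub>R x \<in> N} \<in> sets lborel"
    proof -
      have "(\<lambda>c::real. c *\<^sub>R x) \<in> borel_measurable borel"
        by (intro borel_measurable_continuous_onI continuous_intros)
      from measurable_sets_borel[OF this N]
      have "{1..2::real} \<inter> ((\<lambda>c. c *\<^sub>R x) -` N) \<in> sets lborel" by simp
      then show ?thesis by (simp add: vimage_def Int_def del: atLeastAtMost_iff)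
    qed
    show "{c \<in> {1..2::real}. c *\<^sub>R x \<in> N} \<in> null_sets lborel"
    proof (cases "x = 0")
      case True
      then show ?thesis by (simp add: N_def)
    next
      case False
      define \<nu> where "\<nu> = x /\<^sub>R norm x"
      define T where "T = {t \<in> {0<..<m}. \<forall>k. root DIM('a) t *\<^sub>R \<nu> \<notin> F k}"
      have "negligible T"
        unfolding T_def F_def using False by (intro negligible_uncovered_levels[OF u R m]) (auto simp: \<nu>_def)
      then have "negligible ((\<lambda>t. root DIM('a) t / norm x) ` T)"
      proof (intro negligible_differentiable_image_negligible)
        have "(\<lambda>t. root DIM('a) t / norm x) differentiable (at t within T)" if "t \<in> T" for t
        proof -
          have "(root DIM('a) has_real_derivative inverse (real DIM('a) * root DIM('a) t ^ (DIM('a) - Suc 0))) (at t)"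
            using that by (intro DERIV_real_root) (auto simp: T_def)
          then have "root DIM('a) differentiable (at t within T)"
            by (meson differentiable_at_withinI real_differentiable_def)
          then show ?thesis using False by (intro derivative_intros) auto
        qed
        then show "(\<lambda>t. root DIM('a) t / norm x) differentiable_on T"
          by (simp add: differentiable_on_def)
      qed auto
      \<comment> \<open>A missed radius \<open>c * norm x\<close> corresponds to the missed level
        \<open>(c * norm x) ^ DIM('a)\<close>. The inverse substitution is differentiable at
        positive levels, so it preserves null sets.\<close>
      moreover have "{c \<in> {1..2::real}. c *\<^sub>R x \<in> N} \<subseteq> (\<lambda>t. root DIM('a) t / norm x) ` T"
      proof
        fix c assume "c \<in> {c \<in> {1..2::real}. c *\<^sub>R x \<in> N}"
        then have c: "1 \<le> c" "c *\<^sub>R x \<in> N" by auto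
        define t where "t = (c * norm x) ^ DIM('a)"
        have root: "root DIM('a) t = c * norm x"
          using c by (simp add: t_def real_root_power_cancel)
        have "c * norm x < \<rho>" using c by (simp add: N_def)
        then have "root DIM('a) t < root DIM('a) m" by (simp add: root \<rho>_def)
        then have "t < m" by simp
        moreover have "0 < t" using c False by (simp add: t_def)
        moreover have "root DIM('a) t *\<^sub>R \<nu> \<notin> F k" for k
        proof -
          have "root DIM('a) t *\<^sub>R \<nu> = c *\<^sub>R x"
            using False by (simp add: root \<nu>_def)
          then show ?thesis using c by (simp add: N_def)
        qed
        ultimately have "t \<in> T" by (simp add: T_def)
        then show "c \<in> (\<lambda>t. root DIM('a) t / norm x) ` T"
          using False by (intro image_eqI[of _ _ t]) (simp_all add: root)
      qed
      ultimately have "negligible {c \<in> {1..2::real}. c *\<^sub>R x \<in> N}"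
        by (rule negligible_subset)
      then show ?thesis
        using meas by (simp add: negligible_iff_null_sets null_sets_completion_iff)
    qed
  qed
  moreover have "{0::'a} \<in> null_sets lborel"
    by (simp add: null_sets_def)
  ultimately have null: "N \<union> {0} \<in> null_sets lborel" by (rule null_sets.Un)
  have "emeasure lborel (ball (0::'a) \<rho>) \<le> emeasure lborel ((\<Union>k. F k) \<union> (N \<union> {0}))"
    by (rule emeasure_mono) (use F N in \<open>auto simp: N_def\<close>)
  also have "\<dots> = emeasure lborel (\<Union>k. F k)"
    by (rule emeasure_Un_null_set) (use null F in auto)
  finally show ?thesis
    by (simp add: sup \<rho>_def flip: F_def)
qed

section \<open>Lower bound for the relaxed functional\<close>

text \<open>The covered ball has volume \<open>unit_ball_vol DIM('a) * m\<close>, while the Jacobian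
  bound carries a factor \<open>1 / DIM('a)\<close>. Clearing it turns the volume of the unit ball
  into the area of the unit sphere.\<close>

lemma W_ge:
  fixes u :: "'a::euclidean_space \<Rightarrow> real"
  assumes d2: "DIM('a) \<ge> 2" and u: "C2c (ball 0 R) u" and m: "0 \<le> m" "m < u x0"
  shows "ennreal (DIM('a) * unit_ball_vol DIM('a) * m) \<le> W (ball 0 R) u"
proof (cases "m = 0")
  case False
  define d where "d = DIM('a)"
  define K where "K = real (d - 1) ^ (d - 1)"
  have d: "real d > 0" "K > 0" using d2 by (simp_all add: d_def K_def)
  have C2: "C2 u" using u by (simp add: C2c_def)
  have R: "norm y \<le> R" if "u y \<noteq> 0" for y
    using that u closure_subset[of "{x. u x \<noteq> 0}"] by (force simp: C2c_def)
  define I where "I = (\<integral>\<^sup>+x. ennreal (W_integrand u x) \<partial>lebesgue)"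
  have m0: "0 < m" using m False by simp
  have "ennreal (unit_ball_vol d * m) = emeasure lborel (ball (0::'a) (root d m))"
    using m0 by (simp add: emeasure_ball d_def)
  also have "\<dots> \<le> (SUP k. emeasure lborel (level_normal_map u ` contact_set u R k))"
    unfolding d_def by (rule emeasure_ball_le_level_normal_image[OF C2 R m0 m(2)])
  also have "\<dots> \<le> ennreal (1 / (real d * K)) * I"
    unfolding d_def K_def I_def by (rule SUP_least) (rule emeasure_level_normal_map_le[OF C2 d2])
  finally have "ennreal d * ennreal (unit_ball_vol d * m) \<le> ennreal d * (ennreal (1 / (real d * K)) * I)"
    by (rule mult_left_mono) simp
  also have "\<dots> = ennreal (1 / K) * I"
    using d by (simp add: mult.assoc[symmetric] ennreal_mult[symmetric])
  also have "\<dots> = W (ball 0 R) u"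
    using u by (simp add: W_def I_def K_def d_def)
  finally show ?thesis
    using m0 by (simp add: d_def ennreal_mult[symmetric] mult.assoc)
qed simp

section \<open>Essential support and passage to the relaxed functional\<close>

lemma integrable_lebesgue_on_ball:
  fixes u :: "'a::euclidean_space \<Rightarrow> real"
  assumes "integrable lebesgue u"
  shows "integrable (lebesgue_on (ball c R)) u"
proof -
  have "integrable lebesgue (\<lambda>x. indicator (ball c R) x *\<^sub>R u x)"
    using assms by (intro integrable_mult_indicator) auto
  then show ?thesis
    by (subst integrable_restrict_space) auto
qed

text \<open>The complement is a union of balls on each of which \<open>u\<close> vanishes almost
  everywhere; by the Lindelof property countably many of them suffice.\<close>

lemma AE_zero_outside_esssupp: "AE x in lebesgue. x \<notin> esssupp u \<longrightarrow> u x = 0"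
proof -
  define \<B> where "\<B> = {ball x e | x e. 0 < e \<and> (AE y in lebesgue. y \<in> ball x e \<longrightarrow> u y = 0)}"
  have "\<And>S. S \<in> \<B> \<Longrightarrow> open S" by (auto simp: \<B>_def)
  then obtain \<C> where \<C>: "\<C> \<subseteq> \<B>" "countable \<C>" "\<Union>\<C> = \<Union>\<B>"
    by (rule Lindelof)
  have zero: "AE y in lebesgue. \<forall>S\<in>\<C>. y \<in> S \<longrightarrow> u y = 0"
    using \<C>(1,2) by (subst AE_ball_countable) (auto simp: \<B>_def)
  have cover: "x \<in> \<Union>\<C>" if "x \<notin> esssupp u" for x
  proof -
    from that obtain e where "0 < e" "AE y in lebesgue. y \<in> ball x e \<longrightarrow> u y = 0"
      unfolding esssupp_def by blast
    then have "ball x e \<in> \<B>" "x \<in> ball x e" by (auto simp only: \<B>_def centre_in_ball)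
    then show ?thesis unfolding \<C>(3) by blast
  qed
  from zero show ?thesis
  proof eventually_elim
    case (elim y)
    then show ?case using cover[of y] by blast
  qed
qed

text \<open>A function that is at most \<open>m\<close> everywhere has distance at least
  \<open>\<kappa>\<close>, the integral of the excess of \<open>u\<close> over \<open>m\<close>,
  from \<open>u\<close>. So the approximants eventually exceed \<open>m\<close> somewhere, and
  \<open>W_ge\<close> applies to each smooth one.\<close>

lemma Wbar_ge:
  fixes u :: "'a::euclidean_space \<Rightarrow> real"
  assumes d2: "DIM('a) \<ge> 2" and u: "u \<in> L1cp (ball 0 R)"
    and m: "0 \<le> m" "\<not> (AE x in lebesgue. u x \<le> m)"
  shows "ennreal (DIM('a) * unit_ball_vol DIM('a) * m) \<le> Wbar u (ball 0 R)"
  unfolding Wbar_def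
proof (rule Inf_greatest, safe)
  let ?\<Omega> = "ball (0::'a) R"
  let ?c = "ennreal (DIM('a) * unit_ball_vol DIM('a) * m)"
  fix f :: "nat \<Rightarrow> 'a \<Rightarrow> real"
  assume int_f: "\<forall>n. integrable (lebesgue_on ?\<Omega>) (f n)"
    and lim: "(\<lambda>n. \<integral>x. \<bar>f n x - u x\<bar> \<partial>lebesgue_on ?\<Omega>) \<longlonglongrightarrow> 0"
  have int_u: "integrable (lebesgue_on ?\<Omega>) u"
    using u by (intro integrable_lebesgue_on_ball) (simp add: L1cp_def)
  define w where "w x = max 0 (u x - m)" for x
  have int_w: "integrable (lebesgue_on ?\<Omega>) w"
  proof (rule Bochner_Integration.integrable_bound[OF int_u])
    show "w \<in> borel_measurable (lebesgue_on ?\<Omega>)"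
      using int_u unfolding w_def by measurable
    show "AE x in lebesgue_on ?\<Omega>. norm (w x) \<le> norm (u x)"
      using m by (intro AE_I2) (auto simp: w_def)
  qed
  define \<kappa> where "\<kappa> = (\<integral>x. w x \<partial>lebesgue_on ?\<Omega>)"
  have "\<kappa> \<noteq> 0"
  proof
    assume "\<kappa> = 0"
    moreover have "AE x in lebesgue_on ?\<Omega>. 0 \<le> w x" by (simp add: w_def)
    ultimately have "AE x in lebesgue_on ?\<Omega>. w x = 0"
      using integral_nonneg_eq_0_iff_AE[OF int_w] unfolding \<kappa>_def by blast
    then have "AE x in lebesgue. x \<in> ?\<Omega> \<longrightarrow> w x = 0"
      by (subst (asm) AE_restrict_space_iff) auto
    \<comment> \<open>Outside the ball \<open>u\<close> vanishes almost everywhere, so there it is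
      below \<open>m\<close> as well.\<close>
    moreover have "AE x in lebesgue. x \<notin> esssupp u \<longrightarrow> u x = 0"
      by (rule AE_zero_outside_esssupp)
    ultimately have "AE x in lebesgue. u x \<le> m"
    proof eventually_elim
      case (elim x)
      then show ?case
        using u m by (cases "x \<in> ?\<Omega>") (auto simp: L1cp_def w_def subset_iff)
    qed
    then show False using m by blast
  qed
  moreover have "\<kappa> \<ge> 0" unfolding \<kappa>_def by (rule integral_nonneg_AE) (simp add: w_def)
  ultimately have "\<kappa> > 0" by simp
  then have "\<forall>\<^sub>F n in sequentially. (\<integral>x. \<bar>f n x - u x\<bar> \<partial>lebesgue_on ?\<Omega>) < \<kappa>"
    using order_tendstoD(2)[OF lim] by blast
  then have "\<forall>\<^sub>F n in sequentially. ?c \<le> W ?\<Omega> (f n)"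
  proof eventually_elim
    case (elim n)
    show ?case
    proof (cases "C2c ?\<Omega> (f n)")
      case True
      have "\<exists>x. m < f n x"
      proof (rule ccontr)
        assume "\<not> ?thesis"
        then have le: "f n x \<le> m" for x by (simp add: not_less)
        have "\<kappa> \<le> (\<integral>x. \<bar>f n x - u x\<bar> \<partial>lebesgue_on ?\<Omega>)"
          unfolding \<kappa>_def
        proof (rule integral_mono[OF int_w])
          show "integrable (lebesgue_on ?\<Omega>) (\<lambda>x. \<bar>f n x - u x\<bar>)"
            using int_f int_u by auto
          show "w x \<le> \<bar>f n x - u x\<bar>" for x
            using le[of x] by (simp add: w_def)
        qed
        then show False using elim by simp
      qed
      then show ?thesis using W_ge[OF d2 True m(1)] by blast
    qed (simp add: W_def)
  qed
  then show "?c \<le> liminf (\<lambda>n. W ?\<Omega> (f n))"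
    by (rule Liminf_bounded)
qed

section \<open>Radial functions\<close>

text \<open>
  With the sign, the half-lines in \<open>measure_eqI_lessThan\<close> have finite measure.
\<close>

lemma lborel_distr_neg_norm:
  "distr lborel borel (\<lambda>x::'a::euclidean_space. - norm x) =
    density lborel (\<lambda>s. ennreal (DIM('a) * unit_ball_vol DIM('a) * (- s) ^ (DIM('a) - 1)) * indicator {..0} s)"
    (is "?M = ?N")
proof (rule measure_eqI_lessThan)
  define d where "d = DIM('a)"
  have d: "d > 0" by (simp add: d_def)
  \<comment> \<open>\<open>q s\<close> is the area of the sphere of radius \<open>- s\<close>; its
    antiderivative \<open>F\<close> is minus the volume of the ball.\<close>
  define q where "q s = d * unit_ball_vol d * (- s) ^ (d - 1)" for s :: real
  define F where "F s = - (unit_ball_vol d * (- s) ^ d)" for s :: real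
  have meas_q: "q \<in> borel_measurable borel" unfolding q_def by measurable
  have meas_N: "(\<lambda>s. ennreal (q s) * indicator {..0} s) \<in> borel_measurable lborel"
    using meas_q by simp
  have meas: "(\<lambda>x::'a. - norm x) \<in> borel_measurable borel"
    by (intro borel_measurable_continuous_onI continuous_intros)
  have M: "emeasure ?M {a<..} = ennreal (if a < 0 then unit_ball_vol d * (- a) ^ d else 0)" for a
  proof -
    have "(\<lambda>x::'a. - norm x) -` {a<..} = ball 0 (- a)"
      by auto
    then have "emeasure ?M {a<..} = emeasure lborel (ball (0::'a) (- a))"
      using meas by (simp add: emeasure_distr)
    then show ?thesis
      by (cases "a < 0") (simp_all add: emeasure_ball d_def ball_empty)
  qed
  show "emeasure ?M {a<..} < \<infinity>" for a
    unfolding M by simp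
  show "emeasure ?M {a<..} = emeasure ?N {a<..}" for a
  proof (cases "a < 0")
    case True
    have "emeasure ?N {a<..} = (\<integral>\<^sup>+s. ennreal (q s) * indicator {..0} s * indicator {a<..} s \<partial>lborel)"
      using meas_N by (simp add: emeasure_density q_def d_def)
    \<comment> \<open>Adding the null endpoint \<open>a\<close> gives the closed interval required
      by the fundamental theorem.\<close>
    also have "\<dots> = (\<integral>\<^sup>+s. ennreal (q s) * indicator {a..0} s \<partial>lborel)"
      using AE_lborel_singleton[of a]
      by (intro nn_integral_cong_AE) (auto simp: indicator_def elim: eventually_mono)
    also have "\<dots> = ennreal (F 0 - F a)"
    proof (rule nn_integral_FTC_Icc[OF meas_q])
      show "(F has_real_derivative q s) (at s)" for s
        unfolding F_def q_def using d by (auto intro!: derivative_eq_intros simp: algebra_simps)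
      show "0 \<le> q s" if "s \<in> {a..0}" for s
        using that by (simp add: q_def)
    qed (use True in auto)
    also have "F 0 - F a = unit_ball_vol d * (- a) ^ d"
      using d by (simp add: F_def)
    finally show ?thesis
      unfolding M using True by simp
  next
    case False
    have "emeasure ?N {a<..} = (\<integral>\<^sup>+s. ennreal (q s) * indicator {..0} s * indicator {a<..} s \<partial>lborel)"
      using meas_N by (simp add: emeasure_density q_def d_def)
    also have "\<dots> = (\<integral>\<^sup>+s. 0 \<partial>(lborel::real measure))"
      using False by (intro nn_integral_cong) (auto simp: indicator_def)
    finally show ?thesis
      unfolding M using False by simp
  qed
qed simp_all

text \<open>Polar coordinates for radial integrands, with \<open>- s\<close> as the radius.\<close>

lemma nn_integral_neg_norm:
  assumes "f \<in> borel_measurable borel"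
  shows "(\<integral>\<^sup>+x. f (- norm (x::'a::euclidean_space)) \<partial>lborel) =
    (\<integral>\<^sup>+s. ennreal (DIM('a) * unit_ball_vol DIM('a) * (- s) ^ (DIM('a) - 1)) * indicator {..0} s * f s \<partial>lborel)"
proof -
  have meas: "(\<lambda>x::'a. - norm x) \<in> borel_measurable lborel"
    by simp
  have "(\<integral>\<^sup>+x. f (- norm (x::'a)) \<partial>lborel) = integral\<^sup>N (distr lborel borel (\<lambda>x::'a. - norm x)) f"
    using meas assms by (simp add: nn_integral_distr)
  also have "\<dots> = (\<integral>\<^sup>+s. ennreal (DIM('a) * unit_ball_vol DIM('a) * (- s) ^ (DIM('a) - 1)) * indicator {..0} s * f s \<partial>lborel)"
    unfolding lborel_distr_neg_norm using assms by (subst nn_integral_density) auto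
  finally show ?thesis .
qed

section \<open>Energy of a smooth radial function\<close>

definition decreasing_C2 :: "(real \<Rightarrow> real) \<Rightarrow> bool" where
  "decreasing_C2 \<theta> \<longleftrightarrow> (\<exists>\<theta>' \<theta>''. (\<forall>s. (\<theta> has_real_derivative \<theta>' s) (at s)) \<and>
     (\<forall>s. (\<theta>' has_real_derivative \<theta>'' s) (at s)) \<and> continuous_on UNIV \<theta>'' \<and> (\<forall>s. \<theta>' s \<le> 0))"

text \<open>Profiles are taken in the variable \<open>x \<bullet> x\<close>, which, unlike the norm,
  is smooth at the origin.\<close>

lemma has_derivative_radial:
  assumes "(f has_real_derivative f') (at (x \<bullet> x))"
  shows "((\<lambda>x. f (x \<bullet> x)) has_derivative (\<lambda>h. 2 * f' * (x \<bullet> h))) (at (x::'a::real_inner))"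
proof -
  have "((\<lambda>x::'a. x \<bullet> x) has_derivative (\<lambda>h. x \<bullet> h + h \<bullet> x)) (at x)"
    by (intro derivative_intros)
  from has_derivative_compose[OF this has_field_derivative_imp_has_derivative[OF assms]]
  show ?thesis
    by (rule has_derivative_eq_rhs) (simp add: fun_eq_iff inner_commute)
qed

context
  fixes \<theta> \<theta>' \<theta>'' :: "real \<Rightarrow> real" and w :: "'a::euclidean_space \<Rightarrow> real"
  assumes \<theta>: "\<And>s. (\<theta> has_real_derivative \<theta>' s) (at s)"
    and \<theta>': "\<And>s. (\<theta>' has_real_derivative \<theta>'' s) (at s)"
    and \<theta>'': "continuous_on UNIV \<theta>''" and neg: "\<And>s. \<theta>' s \<le> 0"
    and w: "\<And>x. w x = \<theta> (x \<bullet> x)"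
begin

lemma radial_has_derivative: "(w has_derivative (\<lambda>h. ((2 * \<theta>' (x \<bullet> x)) *\<^sub>R x) \<bullet> h)) (at x)"
proof -
  have "(w has_derivative (\<lambda>h. 2 * \<theta>' (x \<bullet> x) * (x \<bullet> h))) (at x)"
    unfolding w[abs_def] by (rule has_derivative_radial[OF \<theta>])
  then show ?thesis by simp
qed

lemma radial_grad: "grad w x = (2 * \<theta>' (x \<bullet> x)) *\<^sub>R x"
  using radial_has_derivative by (rule grad_eqI)

lemma radial_grad_has_derivative:
  "(grad w has_derivative (\<lambda>h. (2 * \<theta>' (x \<bullet> x)) *\<^sub>R h + (4 * \<theta>'' (x \<bullet> x) * (x \<bullet> h)) *\<^sub>R x)) (at x)"
proof -
  have "((\<lambda>x. 2 * \<theta>' (x \<bullet> x)) has_derivative (\<lambda>h. 2 * (2 * \<theta>'' (x \<bullet> x) * (x \<bullet> h)))) (at x)"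
    by (intro has_derivative_mult_right has_derivative_radial \<theta>')
  from has_derivative_scaleR[OF this has_derivative_ident]
  have "((\<lambda>x. (2 * \<theta>' (x \<bullet> x)) *\<^sub>R x) has_derivative
      (\<lambda>h. (2 * \<theta>' (x \<bullet> x)) *\<^sub>R h + (4 * \<theta>'' (x \<bullet> x) * (x \<bullet> h)) *\<^sub>R x)) (at x)"
    by (rule has_derivative_eq_rhs) (simp add: mult.assoc)
  then show ?thesis
    by (simp add: radial_grad[abs_def])
qed

lemma radial_C2: "C2 w"
  unfolding C2_def
proof (intro conjI allI)
  show "w differentiable at x" for x
    using radial_has_derivative by (rule differentiableI)
  show "grad w differentiable at x" for x
    using radial_grad_has_derivative by (rule differentiableI)
  have "continuous_on UNIV \<theta>'"
    using \<theta>' by (meson DERIV_continuous_on)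
  then have "continuous_on UNIV (\<lambda>x::'a. \<theta>' (x \<bullet> x))" "continuous_on UNIV (\<lambda>x::'a. \<theta>'' (x \<bullet> x))"
    using \<theta>'' by (auto intro!: continuous_on_compose2[of UNIV _ UNIV "\<lambda>x. x \<bullet> x"] continuous_intros)
  then show "continuous_on UNIV (\<lambda>x. frechet_derivative (grad w) (at x) v)" for v
    unfolding frechet_derivative_at[OF radial_grad_has_derivative, symmetric]
    by (intro continuous_intros)
qed

text \<open>Away from critical points the normalised gradient is
  \<open>- (x /\<^sub>R norm x)\<close>, whose divergence is minus \<open>DIM('a) - 1\<close> over
  the radius: the \<open>DIM('a)\<close> diagonal terms lose one for the radial direction.\<close>

lemma radial_W_integrand:
  assumes d2: "DIM('a) \<ge> 2"
  shows "W_integrand w x = (2 * - \<theta>' (x \<bullet> x) * norm x) * (real (DIM('a) - 1) / norm x) ^ (DIM('a) - 1)"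
proof (cases "grad w x = 0")
  \<comment> \<open>Here \<open>x = 0\<close> or the derivative of the profile is zero, and the
    first factor on the right vanishes in either case.\<close>
  case True
  then show ?thesis
    using d2 by (auto simp: W_integrand_def radial_grad)
next
  case False
  then have x: "x \<noteq> 0" "\<theta>' (x \<bullet> x) \<noteq> 0" by (auto simp: radial_grad)
  have cont: "continuous_on UNIV (grad w)"
    by (rule has_derivative_continuous_on[OF has_derivative_at_withinI[OF radial_grad_has_derivative]])
  have op: "open {y. grad w y \<noteq> 0}"
    by (intro open_Collect_neq cont continuous_intros)
  have "((\<lambda>y::'a. y /\<^sub>R norm y) has_derivative (\<lambda>h. h /\<^sub>R norm x - ((x \<bullet> h) / norm x ^ 3) *\<^sub>R x)) (at x)"
    using normalized_has_derivative[OF has_derivative_ident x(1)] .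
  \<comment> \<open>The two unit fields agree only where the gradient is nonzero, but this set is
    open, so their derivatives at \<open>x\<close> agree.\<close>
  from has_derivative_minus[OF this]
  have "((\<lambda>y. grad w y /\<^sub>R norm (grad w y)) has_derivative
      (\<lambda>h. - (h /\<^sub>R norm x - ((x \<bullet> h) / norm x ^ 3) *\<^sub>R x))) (at x)"
  proof (rule has_derivative_transform_within_open[OF _ op])
    fix y assume "y \<in> {y. grad w y \<noteq> 0}"
    then have "\<theta>' (y \<bullet> y) < 0" "y \<noteq> 0"
      using neg[of "y \<bullet> y"] by (auto simp: radial_grad)
    then show "- (y /\<^sub>R norm y) = grad w y /\<^sub>R norm (grad w y)"
      by (simp add: radial_grad)
  qed (use False in auto)
  from frechet_derivative_at[OF this]
  have "divg (\<lambda>y. grad w y /\<^sub>R norm (grad w y)) x = (\<Sum>i\<in>Basis. (- (i /\<^sub>R norm x - ((x \<bullet> i) / norm x ^ 3) *\<^sub>R x)) \<bullet> i)"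
    unfolding divg_def by metis
  also have "\<dots> = (\<Sum>i\<in>Basis. - (1 / norm x) + (x \<bullet> i) * (x \<bullet> i) / norm x ^ 3)"
    by (intro sum.cong refl) (simp add: inner_diff_left divide_inverse)
  also have "\<dots> = - (DIM('a) / norm x) + (x \<bullet> x) / norm x ^ 3"
    unfolding sum.distrib euclidean_inner[of x x] sum_divide_distrib by simp
  also have "\<dots> = - (real (DIM('a) - 1) / norm x)"
    using x d2 by (simp add: dot_square_norm field_simps power2_eq_square power3_eq_cube of_nat_diff)
  finally have "\<bar>divg (\<lambda>y. grad w y /\<^sub>R norm (grad w y)) x\<bar> = real (DIM('a) - 1) / norm x"
    by simp
  moreover have "norm (grad w x) = 2 * - \<theta>' (x \<bullet> x) * norm x"
    using neg[of "x \<bullet> x"] by (simp add: radial_grad)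
  ultimately show ?thesis
    using False by (simp add: W_integrand_def)
qed

text \<open>The power of the radius in the sphere area cancels the one in the curvature term. What
  remains is the derivative of a multiple of \<open>\<theta> (s * s)\<close>, so the integral
  telescopes to the value at the centre.\<close>

lemma nn_integral_radial_W_integrand:
  assumes d2: "DIM('a) \<ge> 2" and A: "\<And>s. A \<le> s \<Longrightarrow> \<theta> s = 0"
  shows "(\<integral>\<^sup>+x. ennreal (W_integrand w x) \<partial>lebesgue) =
    ennreal (real (DIM('a) - 1) ^ (DIM('a) - 1) * (DIM('a) * unit_ball_vol DIM('a) * \<theta> 0))"
proof -
  define d where "d = DIM('a)"
  define K where "K = real (d - 1) ^ (d - 1) * (d * unit_ball_vol d)"
  have K: "K \<ge> 0" by (simp add: K_def)
  define f where "f s = (2 * - \<theta>' (s * s) * - s) * (real (d - 1) / - s) ^ (d - 1)" for s :: real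
  define F where "F s = K * \<theta> (s * s)" for s
  have "continuous_on UNIV \<theta>'"
    using \<theta>' by (meson DERIV_continuous_on)
  then have "(\<lambda>s::real. \<theta>' (s * s)) \<in> borel_measurable borel"
    by (intro borel_measurable_continuous_onI continuous_on_compose2[of UNIV \<theta>' UNIV "\<lambda>s. s * s"] continuous_intros) auto
  then have f: "f \<in> borel_measurable borel" and f': "(\<lambda>s. K * (2 * - \<theta>' (s * s) * - s)) \<in> borel_measurable borel"
    unfolding f_def by measurable
  \<comment> \<open>Below \<open>a\<close> the square \<open>s * s\<close> exceeds \<open>A\<close>
    strictly, so the profile is zero near it and has derivative zero; the extra 1 keeps
    \<open>a\<close> negative.\<close>
  define a where "a = - sqrt \<bar>A\<bar> - 1"
  have a: "a < 0" "A \<le> s * s" if "s \<le> a" for s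
  proof -
    have "A \<le> (sqrt \<bar>A\<bar>)\<^sup>2" by simp
    also have "\<dots> \<le> (- s)\<^sup>2" using that by (intro power_mono) (auto simp: a_def)
    finally show "A \<le> s * s" by (simp add: power2_eq_square)
    have "0 \<le> sqrt \<bar>A\<bar>" by simp
    then show "a < 0" unfolding a_def by linarith
  qed
  have zero: "\<theta>' (s * s) = 0" if "s < a" for s
  proof -
    have "A < s * s"
    proof -
      have "sqrt \<bar>A\<bar> < - s" using that by (simp add: a_def)
      then have "(sqrt \<bar>A\<bar>)\<^sup>2 < (- s)\<^sup>2" by (intro power_strict_mono) auto
      then show ?thesis by (simp add: power2_eq_square abs_less_iff)
    qed
    have "((\<lambda>s. 0) has_real_derivative 0) (at (s * s))" by simp
    then have "(\<theta> has_real_derivative 0) (at (s * s))"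
      by (rule has_field_derivative_transform_within_open[where S = "{A<..}"]) (use \<open>A < s * s\<close> A in auto)
    then show ?thesis using \<theta> DERIV_unique by blast
  qed
  have "(\<integral>\<^sup>+x. ennreal (W_integrand w x) \<partial>lebesgue) = (\<integral>\<^sup>+x. ennreal (f (- norm (x::'a))) \<partial>lborel)"
    unfolding radial_W_integrand[OF d2]
    by (simp add: nn_integral_completion f_def d_def power2_norm_eq_inner[symmetric] power2_eq_square)
  also have "\<dots> = (\<integral>\<^sup>+s. ennreal (d * unit_ball_vol d * (- s) ^ (d - 1)) * indicator {..0} s * ennreal (f s) \<partial>lborel)"
    unfolding d_def by (rule nn_integral_neg_norm) (use f in simp)
  also have "\<dots> = (\<integral>\<^sup>+s. ennreal (K * (2 * - \<theta>' (s * s) * - s)) * indicator {a..0} s \<partial>lborel)"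
  proof (intro nn_integral_cong)
    fix s :: real
    show "ennreal (d * unit_ball_vol d * (- s) ^ (d - 1)) * indicator {..0} s * ennreal (f s) =
        ennreal (K * (2 * - \<theta>' (s * s) * - s)) * indicator {a..0} s"
    proof (cases "a \<le> s \<and> s \<le> 0")
      case True
      have "d * unit_ball_vol d * (- s) ^ (d - 1) * f s = K * (2 * - \<theta>' (s * s) * - s)"
      \<comment> \<open>The cancellation divides by \<open>s\<close>; at the centre both sides
        vanish through the factor \<open>- s\<close>.\<close>
      proof (cases "s = 0")
        case False
        have "(- s) ^ (d - 1) * (real (d - 1) / - s) ^ (d - 1) = real (d - 1) ^ (d - 1)"
          using False by (simp flip: power_mult_distrib)
        then show ?thesis by (simp add: f_def K_def mult_ac)
      qed (simp add: f_def)
      moreover have "0 \<le> d * unit_ball_vol d * (- s) ^ (d - 1)" using True by simp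
      moreover have "0 \<le> f s"
        unfolding f_def using True neg[of "s * s"]
        by (intro mult_nonneg_nonneg zero_le_power divide_nonneg_nonneg) auto
      ultimately show ?thesis
        using True by (simp add: ennreal_mult[symmetric])
    next
      case False
      then show ?thesis
        using zero[of s] by (auto simp: indicator_def f_def)
    qed
  qed
  also have "\<dots> = ennreal (F 0 - F a)"
  proof (rule nn_integral_FTC_Icc[OF f'])
    show "(F has_real_derivative K * (2 * - \<theta>' (s * s) * - s)) (at s)" for s
      unfolding F_def by (auto intro!: derivative_eq_intros DERIV_chain2[OF \<theta>])
    show "0 \<le> K * (2 * - \<theta>' (s * s) * - s)" if "s \<in> {a..0}" for s
      using that K neg[of "s * s"] by (simp add: mult_nonpos_nonpos)
  qed (use a(1)[of a] in simp)
  also have "F 0 - F a = K * \<theta> 0"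
    using a(2)[of a] A by (simp add: F_def)
  finally show ?thesis by (simp add: K_def d_def mult_ac)
qed

end

section \<open>Smooth radial staircases\<close>

text \<open>The exponent is at least 2, so at the kink the difference quotient is bounded by a
  positive power of \<open>\<bar>h\<bar>\<close> and tends to 0.\<close>

lemma DERIV_max_power:
  "((\<lambda>s. max 0 s ^ Suc (Suc n)) has_real_derivative real (Suc (Suc n)) * max 0 s ^ Suc n) (at (s::real))"
proof -
  consider "s > 0" | "s < 0" | "s = 0" by linarith
  then show ?thesis
  proof cases
    case 1
    have "((\<lambda>s. s ^ Suc (Suc n)) has_real_derivative real (Suc (Suc n)) * s ^ Suc n) (at s)"
      using DERIV_pow[of "Suc (Suc n)" s] by simp
    then have "((\<lambda>s. max 0 s ^ Suc (Suc n)) has_real_derivative real (Suc (Suc n)) * s ^ Suc n) (at s)"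
      by (rule has_field_derivative_transform_within_open[where S = "{0<..}"]) (use 1 in \<open>auto simp: max_def\<close>)
    then show ?thesis using 1 by (simp add: max_def)
  next
    case 2
    have "((\<lambda>s. max 0 s ^ Suc (Suc n)) has_real_derivative 0) (at s)"
      by (rule has_field_derivative_transform_within_open[where S = "{..<0}" and f = "\<lambda>s. 0"])
        (use 2 in \<open>auto simp: max_def\<close>)
    then show ?thesis using 2 by (simp add: max_def)
  next
    case 3
    have "((\<lambda>h. (max 0 (0 + h) ^ Suc (Suc n) - max 0 0 ^ Suc (Suc n)) / h) \<longlongrightarrow> 0) (at (0::real))"
    proof (rule Lim_null_comparison)
      have "norm ((max 0 (0 + h) ^ Suc (Suc n) - max 0 0 ^ Suc (Suc n)) / h) \<le> \<bar>h\<bar> ^ Suc n" for h :: real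
      proof (cases "h > 0")
        case False
        then have "(max 0 (0 + h) ^ Suc (Suc n) - max 0 0 ^ Suc (Suc n)) / h = 0" by simp
        then show ?thesis by (simp only: norm_zero zero_le_power abs_ge_zero)
      qed (simp add: max_def)
      then show "\<forall>\<^sub>F h in at 0. norm ((max 0 (0 + h) ^ Suc (Suc n) - max 0 0 ^ Suc (Suc n)) / h) \<le> \<bar>h\<bar> ^ Suc n"
        by (intro always_eventually allI)
      have "((\<lambda>h::real. \<bar>h\<bar> ^ Suc n) \<longlongrightarrow> \<bar>0\<bar> ^ Suc n) (at 0)"
        by (intro tendsto_intros)
      then show "((\<lambda>h::real. \<bar>h\<bar> ^ Suc n) \<longlongrightarrow> 0) (at 0)" by simp
    qed
    then show ?thesis using 3 by (simp add: DERIV_def)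
  qed
qed

text \<open>A decreasing transition from 1 at \<open>a\<close> to 0 at
  \<open>a + \<epsilon>\<close>. Both positive parts are cubed so that two continuous derivatives
  exist across the kinks.\<close>

definition smooth_step :: "real \<Rightarrow> real \<Rightarrow> real \<Rightarrow> real" where
  "smooth_step a \<epsilon> s = max 0 (1 - max 0 ((s - a) / \<epsilon>) ^ 3) ^ 3"

lemma smooth_step_bounds: "0 \<le> smooth_step a \<epsilon> s" "smooth_step a \<epsilon> s \<le> 1"
proof -
  show "0 \<le> smooth_step a \<epsilon> s" by (simp add: smooth_step_def)
  have "0 \<le> max 0 ((s - a) / \<epsilon>) ^ 3" by simp
  then show "smooth_step a \<epsilon> s \<le> 1"
    unfolding smooth_step_def by (intro power_le_one) auto
qed

lemma smooth_step_eq_1: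
  assumes "0 < \<epsilon>" "s \<le> a"
  shows "smooth_step a \<epsilon> s = 1"
proof -
  have "(s - a) / \<epsilon> \<le> 0" using assms by (simp add: divide_nonpos_pos)
  then show ?thesis by (simp add: smooth_step_def max_absorb1)
qed

lemma smooth_step_eq_0:
  assumes "0 < \<epsilon>" "a + \<epsilon> \<le> s"
  shows "smooth_step a \<epsilon> s = 0"
proof -
  have "1 \<le> (s - a) / \<epsilon>" using assms by (simp add: pos_le_divide_eq)
  then have "1 \<le> max 0 ((s - a) / \<epsilon>) ^ 3" by (intro one_le_power) auto
  then show ?thesis by (simp add: smooth_step_def max_def)
qed

text \<open>The first derivative is a multiple of the product of the two squared positive parts,
  which is still differentiable; one further differentiation leaves a continuous function.\<close>

lemma decreasing_C2_smooth_step: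
  assumes "0 < \<epsilon>"
  shows "decreasing_C2 (smooth_step a \<epsilon>)"
proof -
  define l where "l s = (s - a) / \<epsilon>" for s
  define p where "p s = max 0 (l s)" for s
  define q where "q s = max 0 (1 - p s ^ 3)" for s
  have l: "(l has_real_derivative 1 / \<epsilon>) (at s)" for s
    unfolding l_def using assms by (auto intro!: derivative_eq_intros)
  have p2: "((\<lambda>s. p s ^ 2) has_real_derivative 2 * p s * (1 / \<epsilon>)) (at s)" for s
    using DERIV_chain2[OF DERIV_max_power[of 0] l] by (simp add: p_def numeral_2_eq_2)
  have p3: "((\<lambda>s. p s ^ 3) has_real_derivative 3 * p s ^ 2 * (1 / \<epsilon>)) (at s)" for s
    using DERIV_chain2[OF DERIV_max_power[of 1] l] by (simp add: p_def numeral_2_eq_2 numeral_3_eq_3)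
  have p3': "((\<lambda>s. 1 - p s ^ 3) has_real_derivative - (3 * p s ^ 2 * (1 / \<epsilon>))) (at s)" for s
    using DERIV_diff[OF DERIV_const p3, of 1] by simp
  have q2: "((\<lambda>s. q s ^ 2) has_real_derivative 2 * q s * - (3 * p s ^ 2 * (1 / \<epsilon>))) (at s)" for s
    using DERIV_chain2[OF DERIV_max_power[of 0] p3'] by (simp add: q_def numeral_2_eq_2)
  have q3: "((\<lambda>s. q s ^ 3) has_real_derivative 3 * q s ^ 2 * - (3 * p s ^ 2 * (1 / \<epsilon>))) (at s)" for s
    using DERIV_chain2[OF DERIV_max_power[of 1] p3'] by (simp add: q_def numeral_2_eq_2 numeral_3_eq_3)
  have step: "smooth_step a \<epsilon> = (\<lambda>s. q s ^ 3)"
    by (simp add: fun_eq_iff smooth_step_def q_def p_def l_def)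
  show ?thesis
    unfolding decreasing_C2_def
  proof (intro exI conjI allI)
    show "(smooth_step a \<epsilon> has_real_derivative (- 9 / \<epsilon>) * (q s ^ 2 * p s ^ 2)) (at s)" for s
      unfolding step using q3[of s] by (simp add: mult_ac)
    show "((\<lambda>s. (- 9 / \<epsilon>) * (q s ^ 2 * p s ^ 2)) has_real_derivative
        (- 9 / \<epsilon>) * ((2 * q s * - (3 * p s ^ 2 * (1 / \<epsilon>))) * p s ^ 2 + (2 * p s * (1 / \<epsilon>)) * q s ^ 2)) (at s)" for s
      by (intro DERIV_cmult DERIV_mult q2 p2)
    show "continuous_on UNIV (\<lambda>s. (- 9 / \<epsilon>) * ((2 * q s * - (3 * p s ^ 2 * (1 / \<epsilon>))) * p s ^ 2 + (2 * p s * (1 / \<epsilon>)) * q s ^ 2))"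
      unfolding q_def p_def l_def using assms by (intro continuous_intros) auto
    show "(- 9 / \<epsilon>) * (q s ^ 2 * p s ^ 2) \<le> 0" for s
      using assms by (intro mult_nonpos_nonneg) auto
  qed
qed

lemma decreasing_C2_sum:
  assumes "0 \<le> c" "\<And>j. j \<in> J \<Longrightarrow> decreasing_C2 (\<theta> j)"
  shows "decreasing_C2 (\<lambda>s. \<Sum>j\<in>J. c * \<theta> j s)"
proof -
  have "\<forall>j\<in>J. \<exists>\<theta>' \<theta>''. (\<forall>s. (\<theta> j has_real_derivative \<theta>' s) (at s)) \<and>
     (\<forall>s. (\<theta>' has_real_derivative \<theta>'' s) (at s)) \<and> continuous_on UNIV \<theta>'' \<and> (\<forall>s. \<theta>' s \<le> 0)"
    using assms(2) by (simp add: decreasing_C2_def)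
  then obtain \<theta>' \<theta>'' where *: "\<forall>j\<in>J. (\<forall>s. (\<theta> j has_real_derivative \<theta>' j s) (at s)) \<and>
     (\<forall>s. (\<theta>' j has_real_derivative \<theta>'' j s) (at s)) \<and> continuous_on UNIV (\<theta>'' j) \<and> (\<forall>s. \<theta>' j s \<le> 0)"
    unfolding bchoice_iff by blast
  show ?thesis
    unfolding decreasing_C2_def
  proof (intro exI conjI allI)
    show "((\<lambda>s. \<Sum>j\<in>J. c * \<theta> j s) has_real_derivative (\<Sum>j\<in>J. c * \<theta>' j s)) (at s)" for s
      using * by (intro DERIV_sum DERIV_cmult) blast
    show "((\<lambda>s. \<Sum>j\<in>J. c * \<theta>' j s) has_real_derivative (\<Sum>j\<in>J. c * \<theta>'' j s)) (at s)" for s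
      using * by (intro DERIV_sum DERIV_cmult) blast
    show "continuous_on UNIV (\<lambda>s. \<Sum>j\<in>J. c * \<theta>'' j s)"
      using * by (intro continuous_on_sum continuous_on_mult continuous_on_const) blast
    show "(\<Sum>j\<in>J. c * \<theta>' j s) \<le> 0" for s
      using * assms(1) by (intro sum_nonpos mult_nonneg_nonpos) auto
  qed
qed

text \<open>The gap between \<open>A\<close> and the square of \<open>R\<close> keeps the closed
  support inside the open ball. The normalising constant of \<open>W\<close> cancels the power of
  \<open>DIM('a) - 1\<close> left by the curvature.\<close>

lemma W_radial:
  fixes \<theta> :: "real \<Rightarrow> real"
  assumes d2: "DIM('a::euclidean_space) \<ge> 2" and \<theta>: "decreasing_C2 \<theta>"
    and A: "A < R\<^sup>2" "\<And>s. A \<le> s \<Longrightarrow> \<theta> s = 0" and "0 < R"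
  shows "C2c (ball 0 R) (\<lambda>x::'a. \<theta> (x \<bullet> x))"
    and "W (ball 0 R) (\<lambda>x::'a. \<theta> (x \<bullet> x)) = ennreal (DIM('a) * unit_ball_vol DIM('a) * \<theta> 0)"
proof -
  obtain \<theta>' \<theta>'' where *: "\<And>s. (\<theta> has_real_derivative \<theta>' s) (at s)"
     "\<And>s. (\<theta>' has_real_derivative \<theta>'' s) (at s)" "continuous_on UNIV \<theta>''" "\<And>s. \<theta>' s \<le> 0"
    using \<theta> unfolding decreasing_C2_def by blast
  let ?w = "\<lambda>x::'a. \<theta> (x \<bullet> x)"
  have "closure {x. ?w x \<noteq> 0} \<subseteq> {x. x \<bullet> x \<le> A}"
  proof (rule closure_minimal)
    show "{x. ?w x \<noteq> 0} \<subseteq> {x. x \<bullet> x \<le> A}"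
    proof
      fix x :: 'a assume "x \<in> {x. ?w x \<noteq> 0}"
      then show "x \<in> {x. x \<bullet> x \<le> A}" using A(2)[of "x \<bullet> x"] by force
    qed
    show "closed {x::'a. x \<bullet> x \<le> A}" by (intro closed_Collect_le continuous_intros)
  qed
  also have "\<dots> \<subseteq> ball 0 R"
  proof
    fix x :: 'a assume "x \<in> {x. x \<bullet> x \<le> A}"
    then have "(norm x)\<^sup>2 < R\<^sup>2" using A(1) by (simp add: power2_norm_eq_inner)
    then show "x \<in> ball 0 R" using \<open>0 < R\<close> by (simp add: power2_less_imp_less)
  qed
  finally have supp: "closure {x. ?w x \<noteq> 0} \<subseteq> ball 0 R" .
  then have "compact (closure {x. ?w x \<noteq> 0})"
    by (meson bounded_ball bounded_subset closed_closure compact_eq_bounded_closed)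
  then show C2c: "C2c (ball 0 R) ?w"
    using supp radial_C2[OF *, of ?w] by (simp add: C2c_def)
  have pos: "real (DIM('a) - 1) ^ (DIM('a) - 1) > 0"
    using d2 by simp
  have "W (ball 0 R) ?w = ennreal (1 / real (DIM('a) - 1) ^ (DIM('a) - 1)) *
      ennreal (real (DIM('a) - 1) ^ (DIM('a) - 1) * (DIM('a) * unit_ball_vol DIM('a) * \<theta> 0))"
    using C2c nn_integral_radial_W_integrand[OF *, of ?w A] d2 A(2) by (simp add: W_def)
  also have "\<dots> = ennreal (DIM('a) * unit_ball_vol DIM('a) * \<theta> 0)"
    using pos by (subst ennreal_mult'[symmetric]) auto
  finally show "W (ball 0 R) ?w = ennreal (DIM('a) * unit_ball_vol DIM('a) * \<theta> 0)" .
qed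

section \<open>Approximation of radially non-increasing functions\<close>

lemma closed_esssupp: "closed (esssupp u)"
proof -
  have "open (- esssupp u)"
    unfolding open_contains_ball
  proof
    fix x assume "x \<in> - esssupp u"
    then obtain e where e: "0 < e" "AE y in lebesgue. y \<in> ball x e \<longrightarrow> u y = 0"
      by (auto simp: esssupp_def)
    have "z \<in> - esssupp u" if z: "z \<in> ball x e" for z
    proof -
      obtain e' where e': "0 < e'" "ball z e' \<subseteq> ball x e"
        using z by (meson open_ball open_contains_ball)
      have "AE y in lebesgue. y \<in> ball z e' \<longrightarrow> u y = 0"
        using e(2) by eventually_elim (use e'(2) in blast)
      then show ?thesis using e'(1) unfolding esssupp_def by blast
    qed
    then show "\<exists>e>0. ball x e \<subseteq> - esssupp u" using e(1) by blast
  qed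
  then show ?thesis by (simp add: closed_def)
qed

text \<open>The essential support is a compact subset of the open ball, so its largest norm stays
  below \<open>R\<close>. Inserting the origin covers an empty support.\<close>

lemma L1cp_support_radius:
  assumes "v \<in> L1cp (ball (0::'a::euclidean_space) R)" "0 < R"
  obtains \<rho> where "0 \<le> \<rho>" "\<rho> < R" "AE x in lebesgue. \<rho> < norm x \<longrightarrow> v x = 0"
proof -
  have sub: "esssupp v \<subseteq> ball 0 R" using assms by (simp add: L1cp_def)
  have "compact (insert 0 (esssupp v))"
    using closed_esssupp sub by (meson bounded_ball bounded_subset compact_eq_bounded_closed compact_insert)
  then obtain z where z: "z \<in> insert 0 (esssupp v)" "\<And>y. y \<in> insert 0 (esssupp v) \<Longrightarrow> norm y \<le> norm z"
    using continuous_attains_sup[of "insert 0 (esssupp v)" norm] continuous_on_norm_id by blast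
  show ?thesis
  proof
    show "norm z < R" using z(1) sub assms(2) by auto
    show "AE x in lebesgue. norm z < norm x \<longrightarrow> v x = 0"
      using AE_zero_outside_esssupp[of v]
    proof eventually_elim
      case (elim x)
      then show ?case using z(2)[of x] by (meson insertI2 not_le)
    qed
  qed simp
qed

text \<open>If \<open>y\<close> lies in the \<open>k\<close>-th slot of width \<open>w\<close>, then
  all thresholds in earlier slots are below it, those in later slots are above it, and only the one
  in its own slot is undecided. So the sum is \<open>k\<close> or \<open>k + 1\<close> steps. A
  threshold may thus be chosen freely within its slot.\<close>

lemma staircase_approx:
  fixes t :: "nat \<Rightarrow> real"
  assumes w: "0 < w" and t: "\<And>j. j < N \<Longrightarrow> j * w < t j \<and> t j < (j + 1) * w"
    and y: "0 \<le> y" "y \<le> N * w"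
  shows "\<bar>(\<Sum>j<N. w * of_bool (t j \<le> y)) - y\<bar> \<le> w"
proof -
  define k where "k = nat \<lfloor>y / w\<rfloor>"
  have yw: "0 \<le> y / w" "y / w \<le> N" using w y by (simp_all add: pos_divide_le_eq)
  have "real k = of_int \<lfloor>y / w\<rfloor>" using yw by (simp add: k_def)
  then have k: "k \<le> y / w" "y / w < k + 1" by linarith+
  have kN: "k \<le> N" using k(1) yw(2) by linarith
  have k': "k * w \<le> y" "y < (k + 1) * w"
    using k w by (simp_all add: pos_le_divide_eq pos_divide_less_eq)
  have lower: "{..<k} \<subseteq> {j. j < N \<and> t j \<le> y}"
  proof
    fix j assume "j \<in> {..<k}"
    then have j: "j < N" "real j + 1 \<le> k" using kN by auto
    have "(real j + 1) * w \<le> k * w" using j(2) w by (intro mult_right_mono) auto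
    then show "j \<in> {j. j < N \<and> t j \<le> y}" using t[OF j(1)] k'(1) j(1) by simp
  qed
  have upper: "{j. j < N \<and> t j \<le> y} \<subseteq> {..k}"
  proof
    fix j assume "j \<in> {j. j < N \<and> t j \<le> y}"
    then have "j * w < (k + 1) * w" using t[of j] k'(2) by fastforce
    then have "real j < k + 1" using w by (simp add: mult_less_cancel_right)
    then show "j \<in> {..k}" by simp
  qed
  define c where "c = card {j. j < N \<and> t j \<le> y}"
  have c: "k \<le> c" "c \<le> k + 1"
    using card_mono[OF _ lower] card_mono[OF _ upper] by (simp_all add: c_def)
  have sum: "(\<Sum>j<N. w * of_bool (t j \<le> y)) = c * w"
  proof -
    have "(\<Sum>j<N. (of_bool (t j \<le> y) :: real)) = c"
      unfolding c_def by (subst sum_of_bool_eq) (auto simp: Collect_conj_eq lessThan_def)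
    then show ?thesis by (simp only: sum_distrib_left[symmetric] mult.commute)
  qed
  have k2: "y < real k * w + w" using k'(2) by (simp add: algebra_simps)
  have "real k * w \<le> real c * w"
    using c(1) w by (intro mult_right_mono) auto
  moreover have "real c * w \<le> (real k + 1) * w"
    using c(2) w by (intro mult_right_mono) auto
  moreover have "(real k + 1) * w = real k * w + w" by (simp add: algebra_simps)
  ultimately have "real c * w \<le> y + w" "y \<le> real c * w + w"
    using k'(1) k2 by linarith+
  then show ?thesis unfolding sum by linarith
qed

text \<open>Superlevel sets are known to be balls only for almost every level, but every interval
  contains such a level. A radius beyond \<open>\<rho>\<close> would give a nonempty open shell on
  which \<open>v\<close> is positive almost everywhere, although it vanishes there.\<close>

lemma good_level_exists:
  fixes v :: "'a::euclidean_space \<Rightarrow> real"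
  assumes good: "AE t in lborel. t > 0 \<longrightarrow>
        ({x. v x \<ge> t} - cball 0 (r t)) \<union> (cball 0 (r t) - {x. v x \<ge> t}) \<in> null_sets lebesgue"
    and supp: "AE x in lebesgue. \<rho> < norm x \<longrightarrow> v x = 0" and ab: "0 \<le> a" "a < b" and "0 \<le> \<rho>"
  shows "\<exists>t. a < t \<and> t < b \<and> r t \<le> \<rho> \<and> (AE x in lebesgue. t \<le> v x \<longleftrightarrow> norm x \<le> r t)"
proof -
  have "\<exists>t\<in>{a<..<b}. ({x. v x \<ge> t} - cball 0 (r t)) \<union> (cball 0 (r t) - {x. v x \<ge> t}) \<in> null_sets lebesgue"
  proof (rule ccontr)
    assume neg: "\<not> ?thesis"
    have "AE t in lborel. t \<notin> {a<..<b}"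
      using good
    proof eventually_elim
      case (elim t)
      then show ?case using neg ab by auto
    qed
    then have "{a<..<b} \<in> null_sets lborel"
      by (subst (asm) AE_iff_null) (simp_all add: greaterThanLessThan_def greaterThan_def lessThan_def Int_def)
    then show False using ab by (simp add: null_sets_def)
  qed
  then obtain t where t: "a < t" "t < b"
    and null: "({x. v x \<ge> t} - cball 0 (r t)) \<union> (cball 0 (r t) - {x. v x \<ge> t}) \<in> null_sets lebesgue"
    by auto
  have ae: "AE x in lebesgue. t \<le> v x \<longleftrightarrow> norm x \<le> r t"
    using AE_not_in[OF null] by eventually_elim auto
  have "r t \<le> \<rho>"
  proof (rule ccontr)
    assume "\<not> r t \<le> \<rho>"
    then have rt: "\<rho> < r t" by simp
    have "AE x in lebesgue. x \<notin> ball (0::'a) (r t) - cball 0 \<rho>"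
      using ae supp
    proof eventually_elim
      case (elim x)
      then show ?case using t ab by auto
    qed
    then have "ball 0 (r t) - cball (0::'a) \<rho> \<in> null_sets lebesgue"
      by (subst (asm) AE_iff_null_sets[symmetric]) auto
    moreover have "open (ball 0 (r t) - cball (0::'a) \<rho>)" by (intro open_Diff) auto
    ultimately have "ball 0 (r t) - cball (0::'a) \<rho> = {}"
      using open_not_negligible negligible_iff_null_sets by blast
    moreover obtain b :: 'a where "b \<in> Basis" using nonempty_Basis by blast
    then have "((\<rho> + r t) / 2) *\<^sub>R b \<in> ball 0 (r t) - cball 0 \<rho>"
      using rt \<open>0 \<le> \<rho>\<close> by (simp add: abs_of_nonneg)
    ultimately show False by blast
  qed
  then show ?thesis using t ae by blast
qed

text \<open>The staircase \<open>S\<close> is uniformly close to \<open>v\<close>, and smoothing its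
  jumps costs little in L^1. The energy of the smoothed function depends only on its value at the
  centre, which is at most the total height \<open>M\<close> of the steps.\<close>

lemma radial_approximation:
  fixes v :: "'a::euclidean_space \<Rightarrow> real"
  assumes d2: "DIM('a) \<ge> 2" and R: "0 < R" and v: "v \<in> L1cp (ball 0 R)" "radially_nonincr v"
    and M: "0 < M" "AE x in lebesgue. v x \<le> M" and \<delta>: "0 < \<delta>"
  shows "\<exists>f. integrable (lebesgue_on (ball 0 R)) f \<and> (\<integral>x. \<bar>f x - v x\<bar> \<partial>lebesgue_on (ball 0 R)) < \<delta> \<and>
    W (ball 0 R) f \<le> ennreal (DIM('a) * unit_ball_vol DIM('a) * M)"
proof -
  let ?\<Omega> = "ball (0::'a) R"
  obtain r where r: "\<And>t. 0 \<le> r t" "AE t in lborel. t > 0 \<longrightarrow>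
        ({x. v x \<ge> t} - cball 0 (r t)) \<union> (cball 0 (r t) - {x. v x \<ge> t}) \<in> null_sets lebesgue"
    using v(2) unfolding radially_nonincr_def by blast
  obtain \<rho> where \<rho>: "0 \<le> \<rho>" "\<rho> < R" "AE x in lebesgue. \<rho> < norm x \<longrightarrow> v x = 0"
    using L1cp_support_radius[OF v(1) R] by blast
  define V where "V = measure (lebesgue_on ?\<Omega>) ?\<Omega>"
  have fin: "emeasure (lebesgue_on ?\<Omega>) (space (lebesgue_on ?\<Omega>)) \<noteq> \<infinity>"
    using emeasure_lborel_ball_finite[of "0::'a" R] by (simp add: emeasure_restrict_space)
  interpret finite_measure "lebesgue_on ?\<Omega>"
    by (rule finite_measureI) (rule fin)
  obtain n :: nat where n: "2 * M * V / \<delta> < n" using reals_Archimedean2 by blast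
  \<comment> \<open>Enough steps to make the uniform error times the volume less than
    \<open>\<delta> / 2\<close>; the successor ensures that there is at least one.\<close>
  define N where "N = Suc n"
  define w where "w = M / N"
  have w: "0 < w" "N * w = M" using M by (simp_all add: w_def N_def)
  have wV: "w * V < \<delta> / 2"
  proof -
    have "2 * M * V / \<delta> < N" using n by (simp add: N_def)
    then have "2 * M * V < N * \<delta>" using \<delta> by (simp add: pos_divide_less_eq)
    then show ?thesis by (simp add: w_def N_def field_simps)
  qed
  have "\<exists>t. real j * w < t \<and> t < (real j + 1) * w \<and> r t \<le> \<rho> \<and> (AE x in lebesgue. t \<le> v x \<longleftrightarrow> norm x \<le> r t)" for j :: nat
    using w by (intro good_level_exists[OF r(2) \<rho>(3) _ _ \<rho>(1)]) auto
  then obtain t where t: "\<And>j::nat. real j * w < t j" "\<And>j. t j < (real j + 1) * w" "\<And>j. r (t j) \<le> \<rho>"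
    "\<And>j. AE x in lebesgue. t j \<le> v x \<longleftrightarrow> norm x \<le> r (t j)"
    by metis
  define S where "S x = (\<Sum>j<N. w * of_bool (norm x \<le> r (t j)))" for x :: 'a
  have v_S: "AE x in lebesgue. \<bar>S x - v x\<bar> \<le> w"
  proof -
    have "AE x in lebesgue. \<forall>j\<in>{..<N}. t j \<le> v x \<longleftrightarrow> norm x \<le> r (t j)"
      using t(4) by (intro AE_finite_allI) auto
    moreover have "AE x in lebesgue. 0 \<le> v x" using v(1) by (simp add: L1cp_def)
    ultimately show ?thesis using M(2)
    proof eventually_elim
      case (elim x)
      have "S x = (\<Sum>j<N. w * of_bool (t j \<le> v x))"
        unfolding S_def using elim(1) by (intro sum.cong refl) simp
      then show ?case
        using staircase_approx[OF w(1), of N t "v x"] t(1,2) elim w(2) by simp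
    qed
  qed
  \<comment> \<open>Transition widths in the variable \<open>x \<bullet> x\<close>: at most half the
    gap between the squares of \<open>\<rho>\<close> and \<open>R\<close>, so that supports stay
    inside the ball, and tending to 0.\<close>
  define \<epsilon> where "\<epsilon> k = (R\<^sup>2 - \<rho>\<^sup>2) / 2 / Suc k" for k
  have RR: "\<rho>\<^sup>2 < R\<^sup>2" using \<rho> by (intro power_strict_mono) auto
  have \<epsilon>: "0 < \<epsilon> k" "\<rho>\<^sup>2 + \<epsilon> k < R\<^sup>2" for k
  proof -
    show "0 < \<epsilon> k" using RR by (simp add: \<epsilon>_def)
    have "\<epsilon> k \<le> (R\<^sup>2 - \<rho>\<^sup>2) / 2 / 1"
      unfolding \<epsilon>_def using RR by (intro divide_left_mono) auto
    then show "\<rho>\<^sup>2 + \<epsilon> k < R\<^sup>2" using RR by (simp add: field_simps)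
  qed
  define \<theta> where "\<theta> k s = (\<Sum>j<N. w * smooth_step ((r (t j))\<^sup>2) (\<epsilon> k) s)" for k s
  have \<theta>_dec: "decreasing_C2 (\<theta> k)" for k
    unfolding \<theta>_def using w \<epsilon> by (intro decreasing_C2_sum decreasing_C2_smooth_step) auto
  have \<theta>_zero: "\<theta> k s = 0" if "\<rho>\<^sup>2 + \<epsilon> k \<le> s" for k s
  proof -
    have "(r (t j))\<^sup>2 \<le> \<rho>\<^sup>2" for j using r(1) t(3) by (intro power_mono) auto
    then have "(r (t j))\<^sup>2 + \<epsilon> k \<le> s" for j using that by (meson add_right_mono order_trans)
    then show ?thesis
      unfolding \<theta>_def using \<epsilon>(1) by (simp add: smooth_step_eq_0)
  qed
  have \<theta>_bounds: "0 \<le> \<theta> k s" "\<theta> k s \<le> M" for k s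
  proof -
    show "0 \<le> \<theta> k s" unfolding \<theta>_def using w smooth_step_bounds by (intro sum_nonneg) auto
    have "\<theta> k s \<le> (\<Sum>j<N. w * 1)"
      unfolding \<theta>_def using w smooth_step_bounds by (intro sum_mono mult_left_mono) auto
    then show "\<theta> k s \<le> M" using w(2) by simp
  qed
  define f where "f k x = \<theta> k (x \<bullet> x)" for k and x :: 'a
  have W_f: "W ?\<Omega> (f k) \<le> ennreal (DIM('a) * unit_ball_vol DIM('a) * M)" for k
  proof -
    have "W ?\<Omega> (\<lambda>x. \<theta> k (x \<bullet> x)) = ennreal (DIM('a) * unit_ball_vol DIM('a) * \<theta> k 0)"
      by (rule W_radial(2)[OF d2 \<theta>_dec \<epsilon>(2) \<theta>_zero R])
    also have "\<dots> \<le> ennreal (DIM('a) * unit_ball_vol DIM('a) * M)"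
      using \<theta>_bounds by (intro ennreal_leI mult_left_mono) auto
    finally show ?thesis by (simp only: f_def[abs_def])
  qed
  have cont_f: "continuous_on UNIV (f k)" for k
  proof -
    have "C2c ?\<Omega> (\<lambda>x. \<theta> k (x \<bullet> x))"
      by (rule W_radial(1)[OF d2 \<theta>_dec \<epsilon>(2) \<theta>_zero R])
    then have "C2 (f k)"
      by (simp only: C2c_def f_def[abs_def])
    then show ?thesis by (rule C2_facts(3))
  qed
  have f_meas: "f k \<in> borel_measurable (lebesgue_on ?\<Omega>)" for k
    using continuous_on_subset[OF cont_f subset_UNIV] by (intro continuous_imp_measurable_on_sets_lebesgue) auto
  have f_int: "integrable (lebesgue_on ?\<Omega>) (f k)" for k
    using \<theta>_bounds[of k] by (intro integrable_const_bound[where B = M] f_meas) (auto simp: f_def)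
  have S_meas: "S \<in> borel_measurable (lebesgue_on ?\<Omega>)"
  proof -
    have "S \<in> borel_measurable borel" unfolding S_def by measurable
    then show ?thesis
      by (intro measurable_restrict_space1 measurable_completion) simp
  qed
  have S_bounds: "0 \<le> S x" "S x \<le> M" for x
  proof -
    show "0 \<le> S x" unfolding S_def using w by (intro sum_nonneg) auto
    have "S x \<le> (\<Sum>j<N. w * 1)"
      unfolding S_def using w by (intro sum_mono mult_left_mono) auto
    then show "S x \<le> M" using w(2) by simp
  qed
  have S_int: "integrable (lebesgue_on ?\<Omega>) S"
    using S_bounds by (intro integrable_const_bound[where B = M] S_meas) auto
  \<comment> \<open>On each closed ball its smooth step is exactly 1 for all \<open>k\<close>, and
    at a point outside it is eventually 0; so convergence holds at every point, including the
    boundary spheres.\<close>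
  have f_S: "(\<lambda>k. f k x) \<longlonglongrightarrow> S x" for x
    unfolding f_def \<theta>_def S_def
  proof (intro tendsto_sum tendsto_mult tendsto_const)
    fix j
    have xx: "x \<bullet> x = (norm x)\<^sup>2" by (simp only: power2_norm_eq_inner)
    show "(\<lambda>k. smooth_step ((r (t j))\<^sup>2) (\<epsilon> k) (x \<bullet> x)) \<longlonglongrightarrow> of_bool (norm x \<le> r (t j))"
    proof (cases "norm x \<le> r (t j)")
      case True
      then have "x \<bullet> x \<le> (r (t j))\<^sup>2"
        unfolding xx by (intro power_mono) auto
      then show ?thesis using True \<epsilon>(1) by (simp add: smooth_step_eq_1)
    next
      case False
      then have "(r (t j))\<^sup>2 < x \<bullet> x"
        unfolding xx using r(1)[of "t j"] by (intro power_strict_mono) auto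
      then have pos: "0 < x \<bullet> x - (r (t j))\<^sup>2" by simp
      have "(\<lambda>k. (R\<^sup>2 - \<rho>\<^sup>2) / 2 * inverse (real (Suc k))) \<longlonglongrightarrow> (R\<^sup>2 - \<rho>\<^sup>2) / 2 * 0"
        by (intro tendsto_mult tendsto_const LIMSEQ_inverse_real_of_nat)
      then have "\<epsilon> \<longlonglongrightarrow> 0"
        by (simp only: \<epsilon>_def[abs_def] divide_inverse mult_zero_right)
      then have "\<forall>\<^sub>F k in sequentially. \<epsilon> k < x \<bullet> x - (r (t j))\<^sup>2"
        by (rule order_tendstoD(2)) (rule pos)
      then have "\<forall>\<^sub>F k in sequentially. smooth_step ((r (t j))\<^sup>2) (\<epsilon> k) (x \<bullet> x) = 0"
        by eventually_elim (use \<epsilon>(1) in \<open>auto intro!: smooth_step_eq_0\<close>)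
      then show ?thesis using False by (simp add: tendsto_eventually)
    qed
  qed
  have "(\<lambda>k. \<integral>x. \<bar>f k x - S x\<bar> \<partial>lebesgue_on ?\<Omega>) \<longlonglongrightarrow> (\<integral>x. 0 \<partial>lebesgue_on ?\<Omega>)"
  proof (rule integral_dominated_convergence[where w = "\<lambda>x. 2 * M"])
    show "AE x in lebesgue_on ?\<Omega>. (\<lambda>k. \<bar>f k x - S x\<bar>) \<longlonglongrightarrow> 0"
      using tendsto_rabs_zero[OF Lim_null[THEN iffD1, OF f_S]] by (intro AE_I2)
    show "AE x in lebesgue_on ?\<Omega>. norm \<bar>f k x - S x\<bar> \<le> 2 * M" for k
    proof (intro AE_I2)
      fix x
      show "norm \<bar>f k x - S x\<bar> \<le> 2 * M"
        using \<theta>_bounds[of k "x \<bullet> x"] S_bounds[of x] by (simp add: f_def)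
    qed
  qed (use S_meas f_meas in auto)
  then have "\<forall>\<^sub>F k in sequentially. (\<integral>x. \<bar>f k x - S x\<bar> \<partial>lebesgue_on ?\<Omega>) < \<delta> / 2"
    using \<delta> by (intro order_tendstoD(2)[where y = "0::real"]) auto
  then obtain k where k: "(\<integral>x. \<bar>f k x - S x\<bar> \<partial>lebesgue_on ?\<Omega>) < \<delta> / 2"
    unfolding eventually_sequentially by blast
  have v_int: "integrable (lebesgue_on ?\<Omega>) v"
    using v by (intro integrable_lebesgue_on_ball) (simp add: L1cp_def)
  have "(\<integral>x. \<bar>S x - v x\<bar> \<partial>lebesgue_on ?\<Omega>) \<le> (\<integral>x. w \<partial>lebesgue_on ?\<Omega>)"
  proof (rule integral_mono_AE)
    show "AE x in lebesgue_on ?\<Omega>. \<bar>S x - v x\<bar> \<le> w"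
      using v_S by (subst AE_restrict_space_iff) (auto elim: eventually_mono)
  qed (use S_int v_int in auto)
  also have "\<dots> = w * V" by (simp add: V_def)
  finally have S_v: "(\<integral>x. \<bar>S x - v x\<bar> \<partial>lebesgue_on ?\<Omega>) < \<delta> / 2" using wV by linarith
  have "(\<integral>x. \<bar>f k x - v x\<bar> \<partial>lebesgue_on ?\<Omega>) \<le> (\<integral>x. \<bar>f k x - S x\<bar> + \<bar>S x - v x\<bar> \<partial>lebesgue_on ?\<Omega>)"
    using f_int S_int v_int by (intro integral_mono) auto
  also have "\<dots> = (\<integral>x. \<bar>f k x - S x\<bar> \<partial>lebesgue_on ?\<Omega>) + (\<integral>x. \<bar>S x - v x\<bar> \<partial>lebesgue_on ?\<Omega>)"
    using f_int S_int v_int by (intro Bochner_Integration.integral_add) auto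
  also have "\<dots> < \<delta>" using k S_v by linarith
  finally show ?thesis using f_int W_f by blast
qed

section \<open>Minimality of truncation\<close>

text \<open>Approximants with L^1 error below \<open>1 / Suc n\<close> all satisfy one energy bound,
  so they form an admissible sequence for the infimum.\<close>

lemma Wbar_radial_le:
  fixes v :: "'a::euclidean_space \<Rightarrow> real"
  assumes d2: "DIM('a) \<ge> 2" and R: "0 < R" and v: "v \<in> L1cp (ball 0 R)" "radially_nonincr v"
    and M: "0 \<le> M" "AE x in lebesgue. v x \<le> M"
  shows "Wbar v (ball 0 R) \<le> ennreal (DIM('a) * unit_ball_vol DIM('a) * M)"
proof (rule ennreal_le_epsilon)
  define c where "c = DIM('a) * unit_ball_vol DIM('a)"
  have c: "0 < c" unfolding c_def by (intro mult_pos_pos) auto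
  let ?\<Omega> = "ball (0::'a) R"
  fix e :: real assume e: "0 < e"
  \<comment> \<open>The height is raised to become positive, as the approximation requires even when
    \<open>M = 0\<close>; this adds exactly \<open>e\<close> to the energy bound.\<close>
  define M' where "M' = M + e / c"
  have M': "0 < M'" "c * M' = c * M + e" "M \<le> M'"
    using M e c by (simp_all add: M'_def field_simps add_pos_nonneg)
  have "AE x in lebesgue. v x \<le> M'"
    using M(2) by eventually_elim (use M'(3) in linarith)
  then have "\<exists>f. integrable (lebesgue_on ?\<Omega>) f \<and> (\<integral>x. \<bar>f x - v x\<bar> \<partial>lebesgue_on ?\<Omega>) < inverse (real (Suc n)) \<and>
      W ?\<Omega> f \<le> ennreal (DIM('a) * unit_ball_vol DIM('a) * M')" for n
    by (intro radial_approximation[OF d2 R v M'(1)]) auto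
  then obtain f where f: "\<And>n. integrable (lebesgue_on ?\<Omega>) (f n)"
    "\<And>n. (\<integral>x. \<bar>f n x - v x\<bar> \<partial>lebesgue_on ?\<Omega>) < inverse (real (Suc n))"
    "\<And>n. W ?\<Omega> (f n) \<le> ennreal (c * M')"
    unfolding c_def by metis
  have "(\<lambda>n. \<integral>x. \<bar>f n x - v x\<bar> \<partial>lebesgue_on ?\<Omega>) \<longlonglongrightarrow> 0"
  proof (rule tendsto_sandwich[OF _ _ tendsto_const LIMSEQ_inverse_real_of_nat])
    show "\<forall>\<^sub>F n in sequentially. 0 \<le> (\<integral>x. \<bar>f n x - v x\<bar> \<partial>lebesgue_on ?\<Omega>)"
      by (intro always_eventually allI integral_nonneg_AE) simp
    show "\<forall>\<^sub>F n in sequentially. (\<integral>x. \<bar>f n x - v x\<bar> \<partial>lebesgue_on ?\<Omega>) \<le> inverse (real (Suc n))"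
      by (intro always_eventually allI less_imp_le f(2))
  qed
  then have "Wbar v ?\<Omega> \<le> liminf (\<lambda>n. W ?\<Omega> (f n))"
    unfolding Wbar_def using f(1) by (intro Inf_lower) blast
  also have "\<dots> \<le> limsup (\<lambda>n. W ?\<Omega> (f n))"
    by (rule Liminf_le_Limsup) simp
  also have "\<dots> \<le> ennreal (c * M')"
    by (intro Limsup_bounded always_eventually allI f(3))
  also have "\<dots> = ennreal (c * M) + ennreal e"
    using M c e by (simp add: M' ennreal_plus)
  finally show "Wbar v ?\<Omega> \<le> ennreal (DIM('a) * unit_ball_vol DIM('a) * M) + ennreal e"
    by (simp only: c_def)
qed

lemma truncated_L1cp:
  fixes u0 :: "'a::euclidean_space \<Rightarrow> real"
  assumes "u0 \<in> L1cp \<Omega>" "0 \<le> M"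
  shows "(\<lambda>x. min (u0 x) M) \<in> L1cp \<Omega>"
proof -
  have int: "integrable lebesgue u0" and pos: "AE x in lebesgue. 0 \<le> u0 x" and supp: "esssupp u0 \<subseteq> \<Omega>"
    using assms(1) by (auto simp: L1cp_def)
  have "integrable lebesgue (\<lambda>x. min (u0 x) M)"
  proof (rule Bochner_Integration.integrable_bound[OF int])
    show "(\<lambda>x. min (u0 x) M) \<in> borel_measurable lebesgue"
      using int by measurable
    show "AE x in lebesgue. norm (min (u0 x) M) \<le> norm (u0 x)"
      using assms(2) by (intro AE_I2) auto
  qed
  moreover have "AE x in lebesgue. 0 \<le> min (u0 x) M"
    using pos by eventually_elim (use assms(2) in simp)
  moreover have "esssupp (\<lambda>x. min (u0 x) M) \<subseteq> esssupp u0"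
  proof
    fix x assume x: "x \<in> esssupp (\<lambda>x. min (u0 x) M)"
    have "\<not> (AE y in lebesgue. y \<in> ball x e \<longrightarrow> u0 y = 0)" if "e > 0" for e
    proof
      assume "AE y in lebesgue. y \<in> ball x e \<longrightarrow> u0 y = 0"
      then have "AE y in lebesgue. y \<in> ball x e \<longrightarrow> min (u0 y) M = 0"
        by eventually_elim (use assms(2) in auto)
      then show False using x that by (simp add: esssupp_def)
    qed
    then show "x \<in> esssupp u0" by (simp add: esssupp_def)
  qed
  ultimately show ?thesis using supp by (simp add: L1cp_def)
qed

lemma truncated_radially_nonincr:
  fixes u0 :: "'a::euclidean_space \<Rightarrow> real"
  assumes "radially_nonincr u0"
  shows "radially_nonincr (\<lambda>x. min (u0 x) M)"
proof -
  obtain r where r: "\<forall>t. 0 \<le> r t" "AE t in lborel. t > 0 \<longrightarrow>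
        ({x. u0 x \<ge> t} - cball 0 (r t)) \<union> (cball 0 (r t) - {x. u0 x \<ge> t}) \<in> null_sets lebesgue"
    using assms unfolding radially_nonincr_def by blast
  \<comment> \<open>Above \<open>M\<close> the superlevel set is empty, whereas a closed ball of
    radius 0 still contains the origin; that single point is null.\<close>
  define r' where "r' t = (if t \<le> M then r t else 0)" for t
  have "AE t in lborel. t > 0 \<longrightarrow>
        ({x. min (u0 x) M \<ge> t} - cball 0 (r' t)) \<union> (cball 0 (r' t) - {x. min (u0 x) M \<ge> t}) \<in> null_sets lebesgue"
    using r(2)
  proof eventually_elim
    case (elim t)
    show ?case
    proof (cases "t \<le> M")
      case False
      then have "({x. min (u0 x) M \<ge> t} - cball 0 (r' t)) \<union> (cball 0 (r' t) - {x. min (u0 x) M \<ge> t}) = {0}"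
        by (auto simp: r'_def)
      then show ?thesis by (simp flip: negligible_iff_null_sets)
    qed (use elim in \<open>simp add: r'_def\<close>)
  qed
  moreover have "\<forall>t. 0 \<le> r' t" using r(1) by (simp add: r'_def)
  ultimately show ?thesis unfolding radially_nonincr_def by blast
qed

theorem theorem3p3:
  fixes u0 u :: "'a::euclidean_space \<Rightarrow> real" and R0 \<tau> :: real
  assumes "DIM('a) \<ge> 2" and "R0 > 0" and "\<tau> > 0"
    and "u0 \<in> L1cp (ball 0 R0)" and "radially_nonincr u0"
    and "u \<in> L1cp (ball 0 R0)"
  shows "\<exists>v. v \<in> L1cp (ball 0 R0) \<and> radially_nonincr v \<and>
           Fen (ball 0 R0) \<tau> u0 v \<le> Fen (ball 0 R0) \<tau> u0 u"
proof -
  define c where "c = DIM('a) * unit_ball_vol DIM('a)"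
  have c: "0 < c" unfolding c_def by (intro mult_pos_pos) auto
  have lower: "ennreal (c * m) \<le> Wbar u (ball 0 R0)" if "0 \<le> m" "\<not> (AE x in lebesgue. u x \<le> m)" for m
    unfolding c_def by (rule Wbar_ge[OF assms(1,6) that])
  show ?thesis
  proof (cases "\<exists>m\<ge>0. AE x in lebesgue. u x \<le> m")
    case False
    have "Wbar u (ball 0 R0) = \<infinity>"
    proof (rule ccontr)
      assume "Wbar u (ball 0 R0) \<noteq> \<infinity>"
      then obtain b where b: "0 \<le> b" "Wbar u (ball 0 R0) = ennreal b"
        by (cases "Wbar u (ball 0 R0)") auto
      \<comment> \<open>The level \<open>(b + 1) / c\<close> forces the value to be at least
        \<open>b + 1\<close>, against its being \<open>b\<close>.\<close>
      have "ennreal (c * ((b + 1) / c)) \<le> ennreal b"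
        using lower[of "(b + 1) / c"] False b c by auto
      then show False using b c by (simp add: ennreal_le_iff)
    qed
    then have "Fen (ball 0 R0) \<tau> u0 u0 \<le> Fen (ball 0 R0) \<tau> u0 u"
      by (simp add: Fen_def)
    then show ?thesis using assms(4,5) by blast
  next
    case True
    \<comment> \<open>Restricting to nonnegative bounds makes \<open>M\<close> nonnegative, so that
      truncation at \<open>M\<close> stays within the class.\<close>
    define S where "S = {m. 0 \<le> m \<and> (AE x in lebesgue. u x \<le> m)}"
    define M where "M = Inf S"
    have S: "S \<noteq> {}" "bdd_below S" using True by (auto simp: S_def bdd_below_def)
    have M0: "0 \<le> M" unfolding M_def using S by (intro cInf_greatest) (auto simp: S_def)
    have uM: "AE x in lebesgue. u x \<le> M"
    proof -
      \<comment> \<open>The infimum is itself an essential bound, since countably many exceptional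
        null sets suffice to reach it.\<close>
      have "AE x in lebesgue. u x \<le> M + inverse (real (Suc n))" for n
      proof -
        have "Inf S < M + inverse (real (Suc n))" by (simp add: M_def)
        then obtain m where m: "m \<in> S" "m < M + inverse (real (Suc n))"
          using cInf_lessD[OF S(1)] by blast
        from m(1) have "AE x in lebesgue. u x \<le> m" by (simp add: S_def)
        then show ?thesis by eventually_elim (use m(2) in linarith)
      qed
      then have "AE x in lebesgue. \<forall>n. u x \<le> M + inverse (real (Suc n))"
        by (simp add: AE_all_countable)
      then show ?thesis
      proof eventually_elim
        case (elim x)
        have "(\<lambda>n. M + inverse (real (Suc n))) \<longlonglongrightarrow> M + 0"
          by (intro tendsto_add tendsto_const LIMSEQ_inverse_real_of_nat)
        then show ?case using elim by (intro LIMSEQ_le_const[where a = "u x"]) auto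
      qed
    qed
    have WM: "ennreal (c * M) \<le> Wbar u (ball 0 R0)"
    proof (rule ennreal_le_epsilon)
      fix e :: real assume e: "0 < e"
      \<comment> \<open>The lower bound needs a level that \<open>u\<close> exceeds on a set of
        positive measure, so it is applied just below \<open>M\<close>; the loss is exactly
        \<open>e\<close>.\<close>
      define m where "m = M - e / c"
      have m: "m < M" "c * M = c * m + e" using c e by (simp_all add: m_def field_simps)
      show "ennreal (c * M) \<le> Wbar u (ball 0 R0) + ennreal e"
      proof (cases "0 \<le> m")
        case True
        then have "\<not> (AE x in lebesgue. u x \<le> m)"
          using m(1) cInf_lower[OF _ S(2), of m] by (auto simp: S_def M_def)
        then have "ennreal (c * m) + ennreal e \<le> Wbar u (ball 0 R0) + ennreal e"
          by (intro add_right_mono lower True)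
        then show ?thesis using True c e by (simp add: m(2) ennreal_plus)
      next
        case False
        \<comment> \<open>In this case \<open>c * M\<close> is already at most
          \<open>e\<close>.\<close>
        then have "c * m \<le> 0" using c by (simp add: mult_nonneg_nonpos)
        then have "ennreal (c * M) \<le> ennreal e" using m(2) by (intro ennreal_leI) simp
        then show ?thesis by (rule order_trans) simp
      qed
    qed
    define v where "v x = min (u0 x) M" for x
    have v: "v \<in> L1cp (ball 0 R0)" "radially_nonincr v"
      unfolding v_def[abs_def] using truncated_L1cp[OF assms(4) M0] truncated_radially_nonincr[OF assms(5)] by auto
    have "Wbar v (ball 0 R0) \<le> ennreal (c * M)"
      unfolding c_def by (intro Wbar_radial_le assms(1,2) v M0) (simp add: v_def)
    then have W: "Wbar v (ball 0 R0) \<le> Wbar u (ball 0 R0)" using WM by (rule order_trans)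
    have int: "integrable lebesgue u" "integrable lebesgue u0" "integrable lebesgue v"
      using assms(4,6) v(1) by (simp_all add: L1cp_def)
    have "(\<integral>x. \<bar>v x - u0 x\<bar> \<partial>lebesgue) \<le> (\<integral>x. \<bar>u x - u0 x\<bar> \<partial>lebesgue)"
    proof (rule integral_mono_AE)
      \<comment> \<open>Where \<open>u0 x \<le> M\<close> the left side is 0; elsewhere
        \<open>u x \<le> M = v x < u0 x\<close>, so \<open>v x\<close> lies between
        \<open>u x\<close> and \<open>u0 x\<close>.\<close>
      show "AE x in lebesgue. \<bar>v x - u0 x\<bar> \<le> \<bar>u x - u0 x\<bar>"
        using uM by eventually_elim (simp add: v_def)
    qed (use int in auto)
    then have "(\<integral>x. \<bar>v x - u0 x\<bar> \<partial>lebesgue)\<^sup>2 \<le> (\<integral>x. \<bar>u x - u0 x\<bar> \<partial>lebesgue)\<^sup>2"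
      by (intro power_mono integral_nonneg_AE) auto
    then have "1 / (2 * \<tau>) * (\<integral>x. \<bar>v x - u0 x\<bar> \<partial>lebesgue)\<^sup>2 \<le> 1 / (2 * \<tau>) * (\<integral>x. \<bar>u x - u0 x\<bar> \<partial>lebesgue)\<^sup>2"
      using assms(3) by (intro mult_left_mono) auto
    then have "Fen (ball 0 R0) \<tau> u0 v \<le> Fen (ball 0 R0) \<tau> u0 u"
      unfolding Fen_def using W by (intro add_mono ennreal_leI)
    then show ?thesis using v by blast
  qed
qed

end
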